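(* Let $n\ge 3$ be an integer, $\alpha>0$, and equip $\mathrm{St}_{2,n}=\{Y\in\mathbb{R}^{n\times 2}:Y^{\mathsf T}Y=I_2\}$ with the Riemannian metric $$\langle\xi,\eta\rangle=\operatorname{Tr}(\xi^{\mathsf T}\eta)+(\alpha-1)\operatorname{Tr}(\xi^{\mathsf T}YY^{\mathsf T}\eta),\qquad \xi,\eta\in T_Y\mathrm{St}_{2,n}.$$ (1) If $n=3$, then the sectional curvature range of $\mathrm{St}_{2,3}$ is $[\frac{\alpha}{2},\frac{2-3\alpha}{2}]$ if $\alpha\le\frac12$, and $[\frac{2-3\alpha}{2},\frac{\alpha}{2}]$ otherwise. In particular, if $\alpha<\frac23$, $\mathrm{St}_{2,3}$ has strictly positive sectional curvature. (2) If $n>3$, then the sectional curvature range of $\mathrm{St}_{2,n}$ is $[0,\frac{4-3\alpha}{2}]$ if $\alpha\le\frac23$; $[\frac{2-3\alpha}{2},1]$ if $\frac23<\alpha\le2$; and $[\frac{2-3\alpha}{2},\frac{\alpha}{2}]$ if $\alpha>2$. Hence, when $n>3$, $\mathrm{St}_{2,n}$ has non-negative sectional curvature if $\alpha\le\frac23$.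
   Context: The sectional curvature range is the set of all values of the sectional curvature over all two-dimensional subspaces (sections) of tangent spaces. The sign convention is the usual one in which round spheres have positive sectional curvature. *)

theory Defs
  imports "HOL-Analysis.Analysis"
begin

text \<open>
  For a finite-dimensional domain and an open set \<open>S\<close>, \<open>Ck_on k S f\<close> says that \<open>f\<close> is of class
  \<open>C\<^sup>k\<close> on \<open>S\<close>: all iterated directional derivatives of order at most \<open>k\<close> exist and are continuous.
\<close>

primrec Ck_on ::
    "nat \<Rightarrow> 'a set \<Rightarrow> ('a::real_normed_vector \<Rightarrow> 'b::real_normed_vector) \<Rightarrow> bool" where
  "Ck_on 0 S f \<longleftrightarrow> continuous_on S f"
| "Ck_on (Suc k) S f \<longleftrightarrow>
     (\<forall>x\<in>S. f differentiable (at x)) \<and> (\<forall>v. Ck_on k S (\<lambda>x. frechet_derivative f (at x) v))"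

definition smooth_on ::
    "'a set \<Rightarrow> ('a::real_normed_vector \<Rightarrow> 'b::real_normed_vector) \<Rightarrow> bool" where
  "smooth_on S f \<longleftrightarrow> open S \<and> (\<forall>k. Ck_on k S f)"

text \<open>
  Throughout, \<open>M\<close> is meant to be an embedded submanifold of a Euclidean space. Smooth functions and
  smooth vector fields on \<open>M\<close> are represented by smooth maps on an ambient open neighbourhood of
  \<open>M\<close>; only their values on \<open>M\<close> matter, and every smooth function or field on \<open>M\<close> has such an
  extension. A Riemannian metric is represented by a map \<open>g\<close> with \<open>g p u v\<close> the inner product
  of \<open>u, v\<close> in the tangent space at \<open>p\<close>, given by an expression that is smooth in \<open>p\<close> near \<open>M\<close>.
\<close>

definition tangent_space :: "'a::euclidean_space set \<Rightarrow> 'a \<Rightarrow> 'a set" where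
  "tangent_space M p =
     {v. \<exists>c e. e > 0 \<and> smooth_on {-e<..<e} c \<and> c ` {-e<..<e} \<subseteq> M \<and>
               c (0::real) = p \<and> (c has_vector_derivative v) (at 0)}"

definition smooth_near ::
    "'a::euclidean_space set \<Rightarrow> ('a \<Rightarrow> 'b::real_normed_vector) \<Rightarrow> bool" where
  "smooth_near M f \<longleftrightarrow> (\<exists>U. M \<subseteq> U \<and> smooth_on U f)"

definition vector_field :: "'a::euclidean_space set \<Rightarrow> ('a \<Rightarrow> 'a) \<Rightarrow> bool" where
  "vector_field M X \<longleftrightarrow> smooth_near M X \<and> (\<forall>p\<in>M. X p \<in> tangent_space M p)"

text \<open>
  The derivative of \<open>f\<close> along \<open>X\<close>. At points of \<open>M\<close>, where \<open>X\<close> is tangent, it depends only on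
  the restriction of \<open>f\<close> to \<open>M\<close>; likewise for the bracket.
\<close>

definition dir_deriv ::
    "('a::euclidean_space \<Rightarrow> 'a) \<Rightarrow> ('a \<Rightarrow> 'b::real_normed_vector) \<Rightarrow> 'a \<Rightarrow> 'b" where
  "dir_deriv X f p = frechet_derivative f (at p) (X p)"

definition lie_bracket ::
    "('a::euclidean_space \<Rightarrow> 'a) \<Rightarrow> ('a \<Rightarrow> 'a) \<Rightarrow> 'a \<Rightarrow> 'a" where
  "lie_bracket X Y p = dir_deriv X Y p - dir_deriv Y X p"

definition affine_connection ::
    "'a::euclidean_space set \<Rightarrow> (('a \<Rightarrow> 'a) \<Rightarrow> ('a \<Rightarrow> 'a) \<Rightarrow> 'a \<Rightarrow> 'a) \<Rightarrow> bool" where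
  "affine_connection M D \<longleftrightarrow>
     (\<forall>X Y. vector_field M X \<and> vector_field M Y \<longrightarrow> vector_field M (D X Y)) \<and>
     (\<forall>X X' Y. vector_field M X \<and> vector_field M X' \<and> vector_field M Y \<longrightarrow>
        (\<forall>p\<in>M. D (\<lambda>q. X q + X' q) Y p = D X Y p + D X' Y p)) \<and>
     (\<forall>(f :: 'a \<Rightarrow> real) X Y. smooth_near M f \<and> vector_field M X \<and> vector_field M Y \<longrightarrow>
        (\<forall>p\<in>M. D (\<lambda>q. f q *\<^sub>R X q) Y p = f p *\<^sub>R D X Y p)) \<and>
     (\<forall>X Y Y'. vector_field M X \<and> vector_field M Y \<and> vector_field M Y' \<longrightarrow>
        (\<forall>p\<in>M. D X (\<lambda>q. Y q + Y' q) p = D X Y p + D X Y' p)) \<and>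
     (\<forall>(f :: 'a \<Rightarrow> real) X Y. smooth_near M f \<and> vector_field M X \<and> vector_field M Y \<longrightarrow>
        (\<forall>p\<in>M. D X (\<lambda>q. f q *\<^sub>R Y q) p = dir_deriv X f p *\<^sub>R Y p + f p *\<^sub>R D X Y p))"

definition levi_civita_connection ::
    "'a::euclidean_space set \<Rightarrow> ('a \<Rightarrow> 'a \<Rightarrow> 'a \<Rightarrow> real) \<Rightarrow>
     (('a \<Rightarrow> 'a) \<Rightarrow> ('a \<Rightarrow> 'a) \<Rightarrow> 'a \<Rightarrow> 'a) \<Rightarrow> bool" where
  "levi_civita_connection M g D \<longleftrightarrow>
     affine_connection M D \<and>
     (\<forall>X Y. vector_field M X \<and> vector_field M Y \<longrightarrow>
        (\<forall>p\<in>M. D X Y p - D Y X p = lie_bracket X Y p)) \<and>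
     (\<forall>X Y Z. vector_field M X \<and> vector_field M Y \<and> vector_field M Z \<longrightarrow>
        (\<forall>p\<in>M. dir_deriv X (\<lambda>q. g q (Y q) (Z q)) p = g p (D X Y p) (Z p) + g p (Y p) (D X Z p)))"

definition riemann_curvature ::
    "(('a::euclidean_space \<Rightarrow> 'a) \<Rightarrow> ('a \<Rightarrow> 'a) \<Rightarrow> 'a \<Rightarrow> 'a) \<Rightarrow>
     ('a \<Rightarrow> 'a) \<Rightarrow> ('a \<Rightarrow> 'a) \<Rightarrow> ('a \<Rightarrow> 'a) \<Rightarrow> 'a \<Rightarrow> 'a" where
  "riemann_curvature D X Y Z p =
     D X (D Y Z) p - D Y (D X Z) p - D (lie_bracket X Y) Z p"

definition tangent_sections :: "'a::euclidean_space set \<Rightarrow> 'a \<Rightarrow> 'a set set" where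
  "tangent_sections M p = {\<sigma>. subspace \<sigma> \<and> \<sigma> \<subseteq> tangent_space M p \<and> dim \<sigma> = 2}"

text \<open>
  The order of arguments in \<open>R(X,Y)Y\<close>, together with the sign of \<open>R\<close>, makes round spheres
  positively curved. The value is independent of the fields \<open>X, Y\<close> spanning \<open>\<sigma>\<close> at \<open>p\<close>, and the
  values on \<open>M\<close> of the Levi-Civita connection are unique (its values off \<open>M\<close> are not).
\<close>

definition sectional_curvature ::
    "'a::euclidean_space set \<Rightarrow> ('a \<Rightarrow> 'a \<Rightarrow> 'a \<Rightarrow> real) \<Rightarrow> 'a \<Rightarrow> 'a set \<Rightarrow> real" where
  "sectional_curvature M g p \<sigma> =
     (THE k. \<exists>D X Y. levi_civita_connection M g D \<and> vector_field M X \<and> vector_field M Y \<and>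
        span {X p, Y p} = \<sigma> \<and>
        k = g p (riemann_curvature D X Y Y p) (X p) /
              (g p (X p) (X p) * g p (Y p) (Y p) - (g p (X p) (Y p))\<^sup>2))"

definition sectional_curvature_range ::
    "'a::euclidean_space set \<Rightarrow> ('a \<Rightarrow> 'a \<Rightarrow> 'a \<Rightarrow> real) \<Rightarrow> real set" where
  "sectional_curvature_range M g =
     {sectional_curvature M g p \<sigma> | p \<sigma>. p \<in> M \<and> \<sigma> \<in> tangent_sections M p}"

text \<open>The type \<open>real^2^'n\<close> consists of the matrices with rows indexed by \<open>'n\<close> and two columns.\<close>

definition stiefel2 :: "(real^2^'n) set" where
  "stiefel2 = {Y. transpose Y ** Y = mat 1}"

definition stiefel_metric :: "real \<Rightarrow> real^2^'n \<Rightarrow> real^2^'n \<Rightarrow> real^2^'n \<Rightarrow> real" where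
  "stiefel_metric \<alpha> Y \<xi> \<eta> =
     trace (transpose \<xi> ** \<eta>) + (\<alpha> - 1) * trace (transpose \<xi> ** Y ** transpose Y ** \<eta>)"

end

(*
  Write J, R, S for the operations colrot, colneg, colswap, which multiply a matrix on the right by
  the rotation through a right angle and by the two basic traceless symmetric 2x2 matrices. The
  tangent space at Y is the orthogonal complement of Y, R Y, S Y; it is the span of J Y plus the
  horizontal matrices, whose columns are orthogonal to those of Y. The Levi-Civita connection is
  "ambient derivative + Gamma" for an explicit bilinear Gamma.

  For the section spanned by x = A J Y + P and y = B J Y + Q with P, Q horizontal, the sectional
  curvature is

    (U + (1 - 3 alpha / 2) w^2 + alpha^2 T) / (F + 2 alpha T),

  where F is the squared area of the parallelogram of P, Q, w = <P, J Q>, T = |B P - A Q|^2 and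
  U = |p1 /\ q1 + p2 /\ q2|^2 for the columns p1, p2 of P and q1, q2 of Q. Here 0 <= U <= F and
  0 <= w^2 <= F. For n = 3 the horizontal columns all lie on one line, so that U = 0 and w^2 = F.
  These inequalities bound the range, and explicit families of sections fill it.
*)
theory Submission
  imports Defs
begin

section \<open>Calculus of smooth maps\<close>

text \<open>\<open>sectional_curvature\<close> is a definite description over all Levi-Civita
  connections and all pairs of fields spanning the section, and only their values on
  \<open>M\<close> are controlled. Before any formula applies, the curvature at a point must be
  shown to be algebraic in \<open>\<Gamma>\<close> and its derivative. This needs the symmetry of
  second derivatives and the fact that differentiation along tangent vectors ignores values off
  \<open>M\<close>.

  The constants come from reading the quotient as a weighted mean: the T part has ratio \<alpha>/2,
  the F part has ratio (U + m w^2)/F with m = 1 - 3 \<alpha>/2. The latter is m, 1, 1 + m, 0 when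
  (U, w^2) is (0, F), (F, 0), (F, F), (0, 0). Thus \<alpha> = 1/2 is where \<alpha>/2 = m, 2/3 is
  where m changes sign, and 2 is where \<alpha>/2 = 1.\<close>

lemma frechet_derivative_eqI:
  "(f has_derivative f') (at x) \<Longrightarrow> frechet_derivative f (at x) = f'"
  using frechet_derivative_at by force

lemma Ck_on_subset: "Ck_on k S f \<Longrightarrow> T \<subseteq> S \<Longrightarrow> Ck_on k T f"
  by (induction k arbitrary: f) (auto intro: continuous_on_subset)

text \<open>Since \<open>S\<close> is open, \<open>f\<close> and \<open>g\<close> agree near each of
  its points and so have the same derivative there, which is what the induction step needs.\<close>

lemma Ck_on_cong_imp:
  assumes "open S" "\<And>x. x \<in> S \<Longrightarrow> f x = g x" "Ck_on k S f"
  shows "Ck_on k S g"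
  using assms(2,3)
proof (induction k arbitrary: f g)
  case 0
  then show ?case by (auto cong: continuous_on_cong)
next
  case (Suc k)
  have d: "(g has_derivative frechet_derivative f (at x)) (at x)" if "x \<in> S" for x
  proof -
    have "(f has_derivative frechet_derivative f (at x)) (at x)"
      using Suc.prems(2) that frechet_derivative_works by auto
    then show ?thesis
      using has_derivative_transform_within_open assms(1) that Suc.prems(1) by blast
  qed
  have "Ck_on k S (\<lambda>x. frechet_derivative g (at x) v)" for v
  proof (rule Suc.IH)
    show "Ck_on k S (\<lambda>x. frechet_derivative f (at x) v)"
      using Suc.prems(2) by simp
    show "frechet_derivative f (at x) v = frechet_derivative g (at x) v" if "x \<in> S" for x
      using frechet_derivative_eqI[OF d[OF that]] by simp
  qed
  moreover have "g differentiable (at x)" if "x \<in> S" for x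
    using d[OF that] differentiable_def by blast
  ultimately show ?case by simp
qed

text \<open>\<open>frechet_derivative\<close> is a choice; this rule lets a derivative given by an
  explicit formula stand in for it. Most closure properties below differentiate once and apply
  induction.\<close>

lemma Ck_on_SucI:
  assumes "open S" "\<And>x. x \<in> S \<Longrightarrow> (f has_derivative f' x) (at x)"
    "\<And>v. Ck_on k S (\<lambda>x. f' x v)"
  shows "Ck_on (Suc k) S f"
proof -
  have "Ck_on k S (\<lambda>x. frechet_derivative f (at x) v)" for v
    by (rule Ck_on_cong_imp[OF assms(1) _ assms(3)[of v]])
       (simp add: frechet_derivative_eqI[OF assms(2)])
  moreover have "f differentiable (at x)" if "x \<in> S" for x
    using assms(2)[OF that] differentiable_def by blast
  ultimately show ?thesis by simp
qed

lemma Ck_on_SucD: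
  assumes "Ck_on (Suc k) S f" "x \<in> S"
  shows "(f has_derivative frechet_derivative f (at x)) (at x)"
  using assms frechet_derivative_works by auto

lemma Ck_on_Suc_imp: "Ck_on (Suc k) S f \<Longrightarrow> Ck_on k S f"
proof (induction k arbitrary: f)
  case 0
  then show ?case
    by (auto intro!: continuous_at_imp_continuous_on differentiable_imp_continuous_within)
next
  case (Suc k)
  then show ?case by (metis Ck_on.simps(2))
qed

lemma Ck_on_const: "Ck_on k S (\<lambda>x. c)"
  by (induction k arbitrary: c) auto

lemma Ck_on_bounded_linear:
  assumes "bounded_linear L" "open S" "Ck_on k S f"
  shows "Ck_on k S (\<lambda>x. L (f x))"
  using assms(3)
proof (induction k arbitrary: f)
  case 0
  then show ?case by (auto intro: bounded_linear.continuous_on[OF assms(1)])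
next
  case (Suc k)
  show ?case
    by (rule Ck_on_SucI[OF assms(2), where f' = "\<lambda>x v. L (frechet_derivative f (at x) v)"])
       (use Suc in \<open>auto intro!: bounded_linear.has_derivative[OF assms(1)] simp: frechet_derivative_works[symmetric]\<close>)
qed

lemma Ck_on_ident: "open S \<Longrightarrow> Ck_on k S (\<lambda>x. x)"
proof (cases k)
  case (Suc j)
  assume "open S"
  then show ?thesis
    unfolding Suc by (intro Ck_on_SucI[where f' = "\<lambda>x v. v"]) (auto simp: Ck_on_const)
qed auto

lemma Ck_on_add:
  assumes "open S" "Ck_on k S f" "Ck_on k S g"
  shows "Ck_on k S (\<lambda>x. f x + g x)"
  using assms(2,3)
proof (induction k arbitrary: f g)
  case 0
  then show ?case by (auto intro: continuous_intros)
next
  case (Suc k)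
  show ?case
    by (rule Ck_on_SucI[OF assms(1), where
          f' = "\<lambda>x v. frechet_derivative f (at x) v + frechet_derivative g (at x) v"])
       (use Suc in \<open>auto intro!: has_derivative_add simp: frechet_derivative_works[symmetric]\<close>)
qed

text \<open>By the product rule the derivative is a sum of two values of \<open>B\<close>, each with
  one factor differentiated, so the induction has to be general in both factors.\<close>

lemma Ck_on_bilinear:
  assumes B: "bounded_bilinear B" and "open S" "Ck_on k S f" "Ck_on k S g"
  shows "Ck_on k S (\<lambda>x. B (f x) (g x))"
  using assms(3,4)
proof (induction k arbitrary: f g)
  case 0
  then show ?case by (auto intro: bounded_bilinear.continuous_on[OF B])
next
  case (Suc k)
  show ?case
  proof (rule Ck_on_SucI[OF assms(2), where f' = "\<lambda>x v. B (f x) (frechet_derivative g (at x) v)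
        + B (frechet_derivative f (at x) v) (g x)"])
    fix x assume "x \<in> S"
    then show "((\<lambda>x. B (f x) (g x)) has_derivative (\<lambda>v. B (f x) (frechet_derivative g (at x) v)
        + B (frechet_derivative f (at x) v) (g x))) (at x)"
      by (intro bounded_bilinear.FDERIV[OF B] Ck_on_SucD[OF Suc.prems(1)] Ck_on_SucD[OF Suc.prems(2)])
  next
    fix v
    have "Ck_on k S f" "Ck_on k S g"
      using Suc.prems Ck_on_Suc_imp by blast+
    then show "Ck_on k S (\<lambda>x. B (f x) (frechet_derivative g (at x) v)
        + B (frechet_derivative f (at x) v) (g x))"
      using Suc.prems by (intro Ck_on_add[OF assms(2)] Suc.IH) auto
  qed
qed

text \<open>Differentiation lowers the exponent, hence the induction over arbitrary
  \<open>a\<close>. The case of interest is \<open>-1/2\<close>, for normalizing vectors.\<close>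

lemma Ck_on_powr:
  fixes f :: "'a::real_normed_vector \<Rightarrow> real"
  assumes "open S" "\<And>x. x \<in> S \<Longrightarrow> f x > 0" "Ck_on k S f"
  shows "Ck_on k S (\<lambda>x. f x powr a)"
  using assms(3)
proof (induction k arbitrary: a)
  case 0
  then show ?case using assms(2) by (auto intro!: continuous_intros simp: less_imp_neq[symmetric])
next
  case (Suc k)
  show ?case
  proof (rule Ck_on_SucI[OF assms(1), where
        f' = "\<lambda>x v. (a * f x powr (a - 1)) * frechet_derivative f (at x) v"])
    fix x assume x: "x \<in> S"
    have "((\<lambda>x. f x powr a) has_derivative (\<lambda>v. f x powr a *
        (0 * ln (f x) + frechet_derivative f (at x) v * a / f x))) (at x)"
      using x assms(2) Ck_on_SucD[OF Suc.prems] by (intro has_derivative_powr) auto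
    moreover have "f x powr a = f x powr (a - 1) * f x"
      using assms(2)[OF x] powr_add[of "f x" "a - 1" 1] by simp
    ultimately show "((\<lambda>x. f x powr a) has_derivative
        (\<lambda>v. (a * f x powr (a - 1)) * frechet_derivative f (at x) v)) (at x)"
      using assms(2)[OF x] by (simp add: mult_ac)
  next
    fix v
    have "Ck_on k S (\<lambda>x. f x powr (a - 1))"
      using Suc.IH Suc.prems Ck_on_Suc_imp by blast
    moreover have "Ck_on k S (\<lambda>x. frechet_derivative f (at x) v)"
      using Suc.prems by auto
    ultimately show "Ck_on k S (\<lambda>x. (a * f x powr (a - 1)) * frechet_derivative f (at x) v)"
      by (intro Ck_on_bilinear[OF bounded_bilinear_mult] Ck_on_const assms(1)) auto
  qed
qed

lemma smooth_on_subset: "smooth_on S f \<Longrightarrow> open T \<Longrightarrow> T \<subseteq> S \<Longrightarrow> smooth_on T f"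
  unfolding smooth_on_def using Ck_on_subset by blast

lemma smooth_on_cong: "smooth_on S f \<Longrightarrow> (\<And>x. x \<in> S \<Longrightarrow> f x = g x) \<Longrightarrow> smooth_on S g"
  unfolding smooth_on_def using Ck_on_cong_imp[of S f g] by blast

lemma smooth_on_has_derivative:
  "smooth_on S f \<Longrightarrow> x \<in> S \<Longrightarrow> (f has_derivative frechet_derivative f (at x)) (at x)"
  unfolding smooth_on_def by (blast intro: Ck_on_SucD[of 0])

lemma smooth_on_frechet_derivative:
  "smooth_on S f \<Longrightarrow> smooth_on S (\<lambda>x. frechet_derivative f (at x) v)"
  unfolding smooth_on_def using Ck_on.simps(2)[of _ S f] by blast

lemma smooth_on_const: "open S \<Longrightarrow> smooth_on S (\<lambda>x. c)"
  by (simp add: smooth_on_def Ck_on_const)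

lemma smooth_on_ident: "open S \<Longrightarrow> smooth_on S (\<lambda>x. x)"
  by (simp add: smooth_on_def Ck_on_ident)

lemma smooth_on_bounded_linear:
  "bounded_linear L \<Longrightarrow> smooth_on S f \<Longrightarrow> smooth_on S (\<lambda>x. L (f x))"
  by (simp add: smooth_on_def Ck_on_bounded_linear)

lemma smooth_on_add:
  "smooth_on S f \<Longrightarrow> smooth_on S g \<Longrightarrow> smooth_on S (\<lambda>x. f x + g x)"
  by (simp add: smooth_on_def Ck_on_add)

lemma smooth_on_bilinear:
  "bounded_bilinear B \<Longrightarrow> smooth_on S f \<Longrightarrow> smooth_on S g \<Longrightarrow> smooth_on S (\<lambda>x. B (f x) (g x))"
  by (simp add: smooth_on_def Ck_on_bilinear)

lemma smooth_on_powr: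
  fixes f :: "'a::real_normed_vector \<Rightarrow> real"
  shows "smooth_on S f \<Longrightarrow> (\<And>x. x \<in> S \<Longrightarrow> f x > 0) \<Longrightarrow> smooth_on S (\<lambda>x. f x powr a)"
  by (simp add: smooth_on_def Ck_on_powr)

lemmas smooth_on_scaleR = smooth_on_bilinear[OF bounded_bilinear_scaleR]
lemmas smooth_on_mult = smooth_on_bilinear[OF bounded_bilinear_mult]
lemmas smooth_on_inner = smooth_on_bilinear[OF bounded_bilinear_inner]

lemma smooth_on_diff:
  "smooth_on S f \<Longrightarrow> smooth_on S g \<Longrightarrow> smooth_on S (\<lambda>x. f x - g x)"
  using smooth_on_add[of S f "\<lambda>x. - g x"]
    smooth_on_bounded_linear[OF bounded_linear_minus[OF bounded_linear_ident], of S g] by simp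

lemma smooth_on_sum:
  assumes "open S" "\<And>i. i \<in> I \<Longrightarrow> smooth_on S (f i)"
  shows "smooth_on S (\<lambda>x. \<Sum>i\<in>I. f i x)"
  using assms(2)
proof (induction I rule: infinite_finite_induct)
  case (insert i I)
  then show ?case by (simp add: smooth_on_add)
qed (use assms(1) in \<open>auto simp: smooth_on_const\<close>)

text \<open>Smoothness as encoded controls derivatives in fixed directions only. Expanding
  \<open>X x\<close> in the standard basis turns the moving direction into smooth coefficients of
  such derivatives.\<close>

lemma smooth_on_dir_deriv:
  fixes X :: "'a::euclidean_space \<Rightarrow> 'a"
  assumes "smooth_on S X" "smooth_on S f"
  shows "smooth_on S (dir_deriv X f)"
proof -
  have "(\<Sum>b\<in>Basis. (X x \<bullet> b) *\<^sub>R frechet_derivative f (at x) b) = dir_deriv X f x"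
    if "x \<in> S" for x
  proof -
    have "linear (frechet_derivative f (at x))"
      using smooth_on_has_derivative[OF assms(2) that] has_derivative_linear by blast
    then show ?thesis
      unfolding dir_deriv_def
      by (subst (2) euclidean_representation[of "X x", symmetric]) (simp add: linear_sum linear_cmul)
  qed
  moreover have "smooth_on S (\<lambda>x. \<Sum>b\<in>Basis. (X x \<bullet> b) *\<^sub>R frechet_derivative f (at x) b)"
    using assms
    by (intro smooth_on_sum smooth_on_scaleR smooth_on_inner smooth_on_const
        smooth_on_frechet_derivative) (auto simp: smooth_on_def)
  ultimately show ?thesis
    using smooth_on_cong by blast
qed

lemma has_derivative_along_curve:
  assumes "(f has_derivative f') (at (c t))" "(c has_vector_derivative v) (at t)"
  shows "((\<lambda>t. f (c t)) has_vector_derivative f' v) (at t)"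
proof -
  have "((\<lambda>t. f (c t)) has_derivative (\<lambda>h. f' (h *\<^sub>R v))) (at t)"
    using has_derivative_compose[where f = c and x = t and g = f, OF _ assms(1)] assms(2)
    unfolding has_vector_derivative_def by blast
  moreover have "f' (h *\<^sub>R v) = h *\<^sub>R f' v" for h
    using assms(1) has_derivative_linear linear_cmul by blast
  ultimately show ?thesis
    unfolding has_vector_derivative_def by simp
qed

lemma smooth_on_line_derivative:
  fixes f :: "'a::real_normed_vector \<Rightarrow> real"
  assumes "smooth_on S f" "p + s *\<^sub>R u \<in> S"
  shows "((\<lambda>s. f (p + s *\<^sub>R u)) has_real_derivative
           frechet_derivative f (at (p + s *\<^sub>R u)) u) (at s)"
  unfolding has_real_derivative_iff_has_vector_derivative
  by (rule has_derivative_along_curve[where c = "\<lambda>s. p + s *\<^sub>R u",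
        OF smooth_on_has_derivative[OF assms]]) (auto intro!: derivative_eq_intros)

section \<open>Symmetry of second derivatives\<close>

text \<open>The mean value theorem is applied to the increment in direction \<open>v\<close> as a
  function along \<open>u\<close>, then to the \<open>u\<close>-derivative as a function along
  \<open>v\<close>. The left-hand side is an increment over a parallelogram, hence symmetric in
  \<open>u\<close> and \<open>v\<close>.\<close>

lemma second_difference:
  fixes f :: "'a::real_normed_vector \<Rightarrow> real"
  assumes f: "smooth_on S f" and h: "h > 0"
    and S: "\<And>a b. 0 \<le> a \<Longrightarrow> a \<le> h \<Longrightarrow> 0 \<le> b \<Longrightarrow> b \<le> h \<Longrightarrow> p + a *\<^sub>R u + b *\<^sub>R v \<in> S"
  obtains a b where "0 \<le> a" "a \<le> h" "0 \<le> b" "b \<le> h"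
    "f (p + h *\<^sub>R u + h *\<^sub>R v) - f (p + h *\<^sub>R u) - (f (p + h *\<^sub>R v) - f p) =
     h * h * frechet_derivative (\<lambda>y. frechet_derivative f (at y) u)
       (at (p + a *\<^sub>R u + b *\<^sub>R v)) v"
proof -
  let ?f = "\<lambda>y. frechet_derivative f (at y) u"
  have "\<exists>a. 0 < a \<and> a < h \<and>
      (f (p + h *\<^sub>R v + h *\<^sub>R u) - f (p + h *\<^sub>R u)) - (f (p + h *\<^sub>R v + 0 *\<^sub>R u) - f (p + 0 *\<^sub>R u))
      = (h - 0) * (?f (p + h *\<^sub>R v + a *\<^sub>R u) - ?f (p + a *\<^sub>R u))"
  proof (rule MVT2[OF h, where f = "\<lambda>s. f (p + h *\<^sub>R v + s *\<^sub>R u) - f (p + s *\<^sub>R u)"])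
    fix s assume s: "0 \<le> s" "s \<le> h"
    show "((\<lambda>s. f (p + h *\<^sub>R v + s *\<^sub>R u) - f (p + s *\<^sub>R u)) has_real_derivative
       (?f (p + h *\<^sub>R v + s *\<^sub>R u) - ?f (p + s *\<^sub>R u))) (at s)"
      using S[of s h] S[of s 0] s h
      by (intro DERIV_diff smooth_on_line_derivative[OF f]) (auto simp: algebra_simps)
  qed
  then obtain a where a: "0 < a" "a < h"
    "f (p + h *\<^sub>R v + h *\<^sub>R u) - f (p + h *\<^sub>R u) - (f (p + h *\<^sub>R v) - f p)
      = h * (?f (p + h *\<^sub>R v + a *\<^sub>R u) - ?f (p + a *\<^sub>R u))" by auto
  have "\<exists>b. 0 < b \<and> b < h \<and> ?f (p + a *\<^sub>R u + h *\<^sub>R v) - ?f (p + a *\<^sub>R u + 0 *\<^sub>R v)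
      = (h - 0) * frechet_derivative ?f (at (p + a *\<^sub>R u + b *\<^sub>R v)) v"
    using S a(1,2)
    by (intro MVT2[OF h] smooth_on_line_derivative[OF smooth_on_frechet_derivative[OF f]]) auto
  then obtain b where b: "0 < b" "b < h" "?f (p + a *\<^sub>R u + h *\<^sub>R v) - ?f (p + a *\<^sub>R u)
      = h * frechet_derivative ?f (at (p + a *\<^sub>R u + b *\<^sub>R v)) v" by auto
  show thesis
    using a b by (intro that[of a b]) (auto simp: algebra_simps)
qed

definition second_derivative ::
    "('a::real_normed_vector \<Rightarrow> 'b::real_normed_vector) \<Rightarrow> 'a \<Rightarrow> 'a \<Rightarrow> 'a \<Rightarrow> 'b" where
  "second_derivative f x u v = frechet_derivative (\<lambda>y. frechet_derivative f (at y) u) (at x) v"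

text \<open>One parallelogram increment is \<open>h * h\<close> times a value of either mixed
  derivative near \<open>x\<close>, so by continuity the two cannot differ at
  \<open>x\<close>.\<close>

lemma second_derivative_commute_real:
  fixes f :: "'a::real_normed_vector \<Rightarrow> real"
  assumes f: "smooth_on S f" and x: "x \<in> S"
  shows "second_derivative f x u v = second_derivative f x v u"
proof (rule ccontr)
  assume ne: "second_derivative f x u v \<noteq> second_derivative f x v u"
  define e where "e = \<bar>second_derivative f x u v - second_derivative f x v u\<bar> / 2"
  have e: "e > 0" using ne by (simp add: e_def)
  have oS: "open S" using f by (simp add: smooth_on_def)
  have cont: "isCont (\<lambda>y. second_derivative f y u v) x" for u v
    unfolding second_derivative_def
    using smooth_on_has_derivative[OF smooth_on_frechet_derivative[OF smooth_on_frechet_derivative[OF f]] x]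
    by (rule has_derivative_continuous)
  obtain d0 where d0: "d0 > 0" "ball x d0 \<subseteq> S"
    using oS x open_contains_ball by blast
  obtain d1 where d1: "d1 > 0"
    "\<And>y. dist y x < d1 \<Longrightarrow> \<bar>second_derivative f y u v - second_derivative f x u v\<bar> < e"
    using cont[of u v] e unfolding continuous_at_eps_delta dist_real_def by metis
  obtain d2 where d2: "d2 > 0"
    "\<And>y. dist y x < d2 \<Longrightarrow> \<bar>second_derivative f y v u - second_derivative f x v u\<bar> < e"
    using cont[of v u] e unfolding continuous_at_eps_delta dist_real_def by metis
  define d where "d = min d0 (min d1 d2)"
  \<comment> \<open>With this \<open>h\<close> the whole parallelogram stays within distance
    \<open>d\<close> of \<open>x\<close>; the summand 1 covers zero \<open>u\<close> and
    \<open>v\<close> and makes the estimate strict.\<close>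
  define h where "h = d / (norm u + norm v + 1)"
  have d: "d > 0" using d0 d1 d2 by (simp add: d_def)
  have nn: "norm u + norm v + 1 > 0" by (simp add: add_nonneg_pos)
  have h: "h > 0" using d nn by (simp add: h_def)
  have near: "dist (x + a *\<^sub>R u + b *\<^sub>R v) x < d"
    if "0 \<le> a" "a \<le> h" "0 \<le> b" "b \<le> h" for a b
  proof -
    have "dist (x + a *\<^sub>R u + b *\<^sub>R v) x = norm (a *\<^sub>R u + b *\<^sub>R v)"
      by (simp add: dist_norm)
    also have "\<dots> \<le> norm (a *\<^sub>R u) + norm (b *\<^sub>R v)" by (rule norm_triangle_ineq)
    also have "\<dots> \<le> h * norm u + h * norm v"
      using that by (intro add_mono) (auto simp: mult_right_mono)
    also have "\<dots> < h * (norm u + norm v + 1)" using h by (simp add: algebra_simps)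
    also have "\<dots> = d" using nn by (simp add: h_def)
    finally show ?thesis .
  qed
  have inS: "x + a *\<^sub>R u + b *\<^sub>R v \<in> S" if "0 \<le> a" "a \<le> h" "0 \<le> b" "b \<le> h" for a b
    using near[OF that] d0 by (auto simp: d_def dist_commute)
  obtain a b where ab: "0 \<le> a" "a \<le> h" "0 \<le> b" "b \<le> h"
    "f (x + h *\<^sub>R u + h *\<^sub>R v) - f (x + h *\<^sub>R u) - (f (x + h *\<^sub>R v) - f x) =
     h * h * second_derivative f (x + a *\<^sub>R u + b *\<^sub>R v) u v"
    unfolding second_derivative_def using second_difference[OF f h inS] by blast
  have inS': "x + a *\<^sub>R v + b *\<^sub>R u \<in> S" if "0 \<le> a" "a \<le> h" "0 \<le> b" "b \<le> h" for a b
    using inS[of b a] that by (simp add: algebra_simps)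
  obtain a' b' where ab': "0 \<le> a'" "a' \<le> h" "0 \<le> b'" "b' \<le> h"
    "f (x + h *\<^sub>R v + h *\<^sub>R u) - f (x + h *\<^sub>R v) - (f (x + h *\<^sub>R u) - f x) =
     h * h * second_derivative f (x + a' *\<^sub>R v + b' *\<^sub>R u) v u"
    unfolding second_derivative_def using second_difference[OF f h inS'] by blast
  have "h * h * second_derivative f (x + a *\<^sub>R u + b *\<^sub>R v) u v =
        h * h * second_derivative f (x + a' *\<^sub>R v + b' *\<^sub>R u) v u"
  proof -
    have e: "x + h *\<^sub>R v + h *\<^sub>R u = x + h *\<^sub>R u + h *\<^sub>R v" by simp
    then show ?thesis
      using ab(5) ab'(5)[unfolded e] by linarith
  qed
  then have eq: "second_derivative f (x + a *\<^sub>R u + b *\<^sub>R v) u v =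
        second_derivative f (x + a' *\<^sub>R v + b' *\<^sub>R u) v u"
    using h by simp
  have "dist (x + a' *\<^sub>R v + b' *\<^sub>R u) x < d"
    using near[of b' a'] ab' by (simp add: algebra_simps)
  then have "\<bar>second_derivative f (x + a *\<^sub>R u + b *\<^sub>R v) u v - second_derivative f x u v\<bar> < e"
    "\<bar>second_derivative f (x + a' *\<^sub>R v + b' *\<^sub>R u) v u - second_derivative f x v u\<bar> < e"
    using near[of a b] ab d1(2) d2(2) by (auto simp: d_def)
  then show False using eq e_def by argo
qed

lemma second_derivative_commute:
  fixes f :: "'a::real_normed_vector \<Rightarrow> 'b::euclidean_space"
  assumes f: "smooth_on S f" and x: "x \<in> S"
  shows "second_derivative f x u v = second_derivative f x v u"
proof (rule euclidean_eqI)
  fix b :: 'b assume "b \<in> Basis"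
  have oS: "open S" using f by (simp add: smooth_on_def)
  have bl: "bounded_linear (\<lambda>y. y \<bullet> b)" by (rule bounded_linear_inner_left)
  have D: "frechet_derivative (\<lambda>z. F z \<bullet> b) (at y) w = frechet_derivative F (at y) w \<bullet> b"
    if "smooth_on S F" "y \<in> S" for F :: "'a \<Rightarrow> 'b" and y w
    using frechet_derivative_eqI[OF bounded_linear.has_derivative[OF bl smooth_on_has_derivative[OF that]]]
    by simp
  have "second_derivative (\<lambda>z. f z \<bullet> b) x u v = second_derivative f x u v \<bullet> b" for u v
  proof -
    have "frechet_derivative (\<lambda>y. frechet_derivative (\<lambda>z. f z \<bullet> b) (at y) u) (at x) =
        frechet_derivative (\<lambda>y. frechet_derivative f (at y) u \<bullet> b) (at x)"
    proof (rule frechet_derivative_eqI)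
      show "((\<lambda>y. frechet_derivative (\<lambda>z. f z \<bullet> b) (at y) u) has_derivative
          frechet_derivative (\<lambda>y. frechet_derivative f (at y) u \<bullet> b) (at x)) (at x)"
        using smooth_on_has_derivative[OF smooth_on_bounded_linear[OF bl smooth_on_frechet_derivative[OF f]] x]
        by (rule has_derivative_transform_within_open[OF _ oS x]) (simp add: D[OF f])
    qed
    then show ?thesis
      unfolding second_derivative_def
      using D[OF smooth_on_frechet_derivative[OF f] x, of u v] by simp
  qed
  then show "second_derivative f x u v \<bullet> b = second_derivative f x v u \<bullet> b"
    using second_derivative_commute_real[OF smooth_on_bounded_linear[OF bl f] x, of u v] by metis
qed

lemma linear_second_derivative:
  fixes f :: "'a::real_normed_vector \<Rightarrow> 'b::euclidean_space"
  assumes "smooth_on S f" "x \<in> S"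
  shows "linear (second_derivative f x u)" "linear (\<lambda>u. second_derivative f x u v)"
proof -
  show *: "linear (second_derivative f x u)" for u
    unfolding second_derivative_def
    using smooth_on_has_derivative[OF smooth_on_frechet_derivative[OF assms(1)] assms(2)]
    by (rule has_derivative_linear)
  show "linear (\<lambda>u. second_derivative f x u v)"
    unfolding second_derivative_commute[OF assms, of _ v] using *[of v] .
qed

lemma linear_sum_Basis:
  fixes L :: "'a::euclidean_space \<Rightarrow> 'b::real_vector"
  assumes "linear L"
  shows "(\<Sum>b\<in>Basis. (x \<bullet> b) *\<^sub>R L b) = L x"
  by (subst (2) euclidean_representation[of x, symmetric])
     (simp add: linear_sum[OF assms] linear_cmul[OF assms])

lemma has_derivative_dir_deriv:
  fixes X :: "'a::euclidean_space \<Rightarrow> 'a" and f :: "'a \<Rightarrow> 'b::euclidean_space"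
  assumes X: "smooth_on S X" and f: "smooth_on S f" and p: "p \<in> S"
  shows "(dir_deriv X f has_derivative (\<lambda>v. second_derivative f p (X p) v +
           frechet_derivative f (at p) (frechet_derivative X (at p) v))) (at p)"
proof -
  have oS: "open S" using f by (simp add: smooth_on_def)
  have "((\<lambda>x. \<Sum>b\<in>Basis. (X x \<bullet> b) *\<^sub>R frechet_derivative f (at x) b) has_derivative
     (\<lambda>v. \<Sum>b\<in>Basis. (X p \<bullet> b) *\<^sub>R second_derivative f p b v +
        (frechet_derivative X (at p) v \<bullet> b) *\<^sub>R frechet_derivative f (at p) b)) (at p)"
    unfolding second_derivative_def
    by (intro has_derivative_sum bounded_bilinear.FDERIV[OF bounded_bilinear_scaleR]
        bounded_linear.has_derivative[OF bounded_linear_inner_left]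
        smooth_on_has_derivative[OF X p]
        smooth_on_has_derivative[OF smooth_on_frechet_derivative[OF f] p])
  then have "((\<lambda>x. \<Sum>b\<in>Basis. (X x \<bullet> b) *\<^sub>R frechet_derivative f (at x) b) has_derivative
     (\<lambda>v. second_derivative f p (X p) v +
           frechet_derivative f (at p) (frechet_derivative X (at p) v))) (at p)"
    by (simp add: sum.distrib linear_sum_Basis[OF linear_second_derivative(2)[OF f p]]
        linear_sum_Basis[OF has_derivative_linear[OF smooth_on_has_derivative[OF f p]]])
  then show ?thesis
    by (rule has_derivative_transform_within_open[OF _ oS p])
       (simp add: dir_deriv_def
         linear_sum_Basis[OF has_derivative_linear[OF smooth_on_has_derivative[OF f]]])
qed

section \<open>Connections and curvature of embedded manifolds\<close>

lemma smooth_near_Int: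
  assumes "smooth_near M f" "smooth_near M h"
  obtains U where "M \<subseteq> U" "smooth_on U f" "smooth_on U h"
proof -
  obtain U V where "M \<subseteq> U" "smooth_on U f" "M \<subseteq> V" "smooth_on V h"
    using assms unfolding smooth_near_def by blast
  moreover from this have "open (U \<inter> V)"
    unfolding smooth_on_def by blast
  ultimately show thesis
    by (intro that[of "U \<inter> V"]) (blast intro: smooth_on_subset)+
qed

lemma smooth_near_has_derivative:
  "smooth_near M f \<Longrightarrow> p \<in> M \<Longrightarrow> (f has_derivative frechet_derivative f (at p)) (at p)"
  unfolding smooth_near_def using smooth_on_has_derivative by blast

lemma smooth_near_diff:
  assumes "smooth_near M f" "smooth_near M h"
  shows "smooth_near M (\<lambda>x. f x - h x)"
  using smooth_near_Int[OF assms] smooth_on_diff unfolding smooth_near_def by metis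

lemma smooth_near_dir_deriv:
  assumes "smooth_near M X" "smooth_near M f"
  shows "smooth_near M (dir_deriv X f)"
  using smooth_near_Int[OF assms] smooth_on_dir_deriv unfolding smooth_near_def by metis

text \<open>A tangent vector is the velocity of a curve in \<open>M\<close>, along which
  \<open>f\<close> and \<open>h\<close> coincide. This is how undetermined values off
  \<open>M\<close> drop out, and also how the equations defining a submanifold are
  differentiated.\<close>

lemma derivative_along_tangent_cong:
  assumes "(f has_derivative f') (at p)" "(h has_derivative h') (at p)"
    and eq: "\<And>q. q \<in> M \<Longrightarrow> f q = h q" and v: "v \<in> tangent_space M p"
  shows "f' v = h' v"
proof -
  obtain c e where c: "e > 0" "c ` {-e<..<e} \<subseteq> M" "c (0::real) = p"
    "(c has_vector_derivative v) (at 0)"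
    using v unfolding tangent_space_def by blast
  have f: "((\<lambda>t. f (c t)) has_vector_derivative f' v) (at 0)"
    and h: "((\<lambda>t. h (c t)) has_vector_derivative h' v) (at 0)"
    using assms(1,2) c by (auto intro!: has_derivative_along_curve[where c = c])
  have "((\<lambda>t. h (c t)) has_vector_derivative f' v) (at 0)"
    using f unfolding has_vector_derivative_def
    by (rule has_derivative_transform_within_open[of _ _ _ _ "{-e<..<e}"]) (use c eq in \<open>auto simp: image_subset_iff\<close>)
  then show ?thesis
    using h vector_derivative_unique_at by blast
qed

text \<open>
  The map \<open>\<Gamma>\<close> is an extension of the Christoffel symbols to the ambient space, and \<open>d\<Gamma>\<close> is its
  derivative in the base point: \<open>d\<Gamma> p v x y\<close> is the derivative of \<open>\<Gamma> q x y\<close> at \<open>q = p\<close> in the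
  direction \<open>v\<close>.
\<close>

locale christoffel =
  fixes M :: "'a::euclidean_space set" and g :: "'a \<Rightarrow> 'a \<Rightarrow> 'a \<Rightarrow> real"
    and \<Gamma> :: "'a \<Rightarrow> 'a \<Rightarrow> 'a \<Rightarrow> 'a" and d\<Gamma> :: "'a \<Rightarrow> 'a \<Rightarrow> 'a \<Rightarrow> 'a \<Rightarrow> 'a"
  assumes g_bilinear: "bilinear (g p)"
    and g_sym: "g p x y = g p y x"
    and g_pos: "p \<in> M \<Longrightarrow> v \<in> tangent_space M p \<Longrightarrow> v \<noteq> 0 \<Longrightarrow> g p v v > 0"
    and subspace_tangent: "p \<in> M \<Longrightarrow> subspace (tangent_space M p)"
    and field_extension:
      "p \<in> M \<Longrightarrow> v \<in> tangent_space M p \<Longrightarrow> \<exists>X. vector_field M X \<and> X p = v"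
    and \<Gamma>_bilinear: "bilinear (\<Gamma> p)"
    and \<Gamma>_sym: "\<Gamma> p x y = \<Gamma> p y x"
    and \<Gamma>_smooth: "smooth_on U X \<Longrightarrow> smooth_on U Y \<Longrightarrow> smooth_on U (\<lambda>q. \<Gamma> q (X q) (Y q))"
    and \<Gamma>_has_derivative: "(X has_derivative X') (at p) \<Longrightarrow> (Y has_derivative Y') (at p) \<Longrightarrow>
       ((\<lambda>q. \<Gamma> q (X q) (Y q)) has_derivative
         (\<lambda>v. d\<Gamma> p v (X p) (Y p) + \<Gamma> p (X' v) (Y p) + \<Gamma> p (X p) (Y' v))) (at p)"
    and tangential: "vector_field M X \<Longrightarrow> vector_field M Y \<Longrightarrow> p \<in> M \<Longrightarrow>
       dir_deriv X Y p + \<Gamma> p (X p) (Y p) \<in> tangent_space M p"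
    and compatible: "vector_field M X \<Longrightarrow> vector_field M Y \<Longrightarrow> vector_field M Z \<Longrightarrow> p \<in> M \<Longrightarrow>
       dir_deriv X (\<lambda>q. g q (Y q) (Z q)) p =
         g p (dir_deriv X Y p + \<Gamma> p (X p) (Y p)) (Z p) +
         g p (Y p) (dir_deriv X Z p + \<Gamma> p (X p) (Z p))"
begin

definition nabla :: "('a \<Rightarrow> 'a) \<Rightarrow> ('a \<Rightarrow> 'a) \<Rightarrow> 'a \<Rightarrow> 'a" where
  "nabla X Y p = dir_deriv X Y p + \<Gamma> p (X p) (Y p)"

text \<open>The classical coordinate formula for the curvature tensor in terms of Christoffel
  symbols, taken relative to the flat connection of the ambient space.\<close>

definition curv :: "'a \<Rightarrow> 'a \<Rightarrow> 'a \<Rightarrow> 'a \<Rightarrow> 'a" where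
  "curv p x y z = d\<Gamma> p x y z - d\<Gamma> p y x z + \<Gamma> p x (\<Gamma> p y z) - \<Gamma> p y (\<Gamma> p x z)"

lemma vector_fieldD:
  assumes "vector_field M X"
  shows "smooth_near M X" "p \<in> M \<Longrightarrow> X p \<in> tangent_space M p"
    "p \<in> M \<Longrightarrow> (X has_derivative frechet_derivative X (at p)) (at p)"
  using assms smooth_near_has_derivative unfolding vector_field_def by blast+

lemma vector_field_nabla:
  assumes X: "vector_field M X" and Y: "vector_field M Y"
  shows "vector_field M (nabla X Y)"
proof -
  obtain U where U: "M \<subseteq> U" "smooth_on U X" "smooth_on U Y"
    using smooth_near_Int vector_fieldD(1) X Y by metis
  then have "smooth_on U (nabla X Y)"
    unfolding nabla_def[abs_def] by (intro smooth_on_add smooth_on_dir_deriv \<Gamma>_smooth)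
  then show ?thesis
    using U(1) tangential[OF X Y] unfolding vector_field_def smooth_near_def nabla_def by blast
qed

lemma levi_civita_nabla: "levi_civita_connection M g nabla"
proof -
  have lin: "linear (frechet_derivative X (at p))" if "smooth_near M X" "p \<in> M" for X :: "'a \<Rightarrow> 'a" and p
    using smooth_near_has_derivative[OF that] by (rule has_derivative_linear)
  have "affine_connection M nabla"
    unfolding affine_connection_def
  proof (intro conjI allI impI ballI; (elim conjE)?)
    fix X Y assume XY: "vector_field M X" "vector_field M Y"
    show "vector_field M (nabla X Y)" using vector_field_nabla[OF XY] .
    fix X' p assume "vector_field M X'" and p: "p \<in> M"
    then show "nabla (\<lambda>q. X q + X' q) Y p = nabla X Y p + nabla X' Y p"
      using lin[OF vector_fieldD(1)[OF XY(2)] p]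
      by (simp add: nabla_def dir_deriv_def linear_add bilinear_ladd[OF \<Gamma>_bilinear])
  next
    fix f :: "'a \<Rightarrow> real" and X Y p
    assume "vector_field M X" "vector_field M Y" "p \<in> M"
    then show "nabla (\<lambda>q. f q *\<^sub>R X q) Y p = f p *\<^sub>R nabla X Y p"
      using lin[OF vector_fieldD(1)]
      by (simp add: nabla_def dir_deriv_def linear_cmul bilinear_lmul[OF \<Gamma>_bilinear] scaleR_add_right)
  next
    fix X Y Y' p
    assume X: "vector_field M X" "vector_field M Y" "vector_field M Y'" "p \<in> M"
    show "nabla X (\<lambda>q. Y q + Y' q) p = nabla X Y p + nabla X Y' p"
      using frechet_derivative_eqI[OF has_derivative_add[OF vector_fieldD(3)[OF X(2,4)]
            vector_fieldD(3)[OF X(3,4)]]]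
      by (simp add: nabla_def dir_deriv_def bilinear_radd[OF \<Gamma>_bilinear])
  next
    fix f :: "'a \<Rightarrow> real" and X Y p
    assume X: "smooth_near M f" "vector_field M X" "vector_field M Y" "p \<in> M"
    show "nabla X (\<lambda>q. f q *\<^sub>R Y q) p = dir_deriv X f p *\<^sub>R Y p + f p *\<^sub>R nabla X Y p"
      using frechet_derivative_eqI[OF bounded_bilinear.FDERIV[OF bounded_bilinear_scaleR
            smooth_near_has_derivative[OF X(1,4)] vector_fieldD(3)[OF X(3,4)]]]
      by (simp add: nabla_def dir_deriv_def bilinear_rmul[OF \<Gamma>_bilinear] scaleR_add_right)
  qed
  moreover have "nabla X Y p - nabla Y X p = lie_bracket X Y p" for X Y p
    using \<Gamma>_sym by (simp add: nabla_def lie_bracket_def)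
  ultimately show ?thesis
    using compatible unfolding levi_civita_connection_def nabla_def by blast
qed

lemma levi_civita_vector_field:
  assumes "levi_civita_connection M g D" "vector_field M X" "vector_field M Y"
  shows "vector_field M (D X Y)"
proof -
  have "\<forall>X Y. vector_field M X \<and> vector_field M Y \<longrightarrow> vector_field M (D X Y)"
    using assms(1) unfolding levi_civita_connection_def affine_connection_def
    by (elim conjE) assumption
  then show ?thesis using assms(2,3) by blast
qed

lemma levi_civita_torsion:
  assumes "levi_civita_connection M g D" "vector_field M X" "vector_field M Y" "p \<in> M"
  shows "D X Y p - D Y X p = lie_bracket X Y p"
  using assms unfolding levi_civita_connection_def by blast

text \<open>
  The difference of two Levi-Civita connections, paired with a third field, is symmetric in the
  first two arguments and skew in the last two, hence zero.
\<close>

lemma levi_civita_unique: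
  assumes D: "levi_civita_connection M g D"
    and X: "vector_field M X" and Y: "vector_field M Y" and p: "p \<in> M"
  shows "D X Y p = nabla X Y p"
proof -
  let ?S = "\<lambda>X Y. D X Y p - nabla X Y p"
  have tan: "?S X Y \<in> tangent_space M p" if "vector_field M X" "vector_field M Y" for X Y
    using levi_civita_vector_field[OF D that] vector_field_nabla[OF that] p
    by (intro subspace_diff[OF subspace_tangent[OF p]] vector_fieldD(2))
  have sym: "?S X Y = ?S Y X" if "vector_field M X" "vector_field M Y" for X Y
  proof -
    have "D X Y p - D Y X p = nabla X Y p - nabla Y X p"
      using levi_civita_torsion[OF D that p] levi_civita_torsion[OF levi_civita_nabla that p] by simp
    then show ?thesis by (simp add: algebra_simps)
  qed
  have skew: "g p (?S X Y) (Z p) = - g p (?S X Z) (Y p)"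
    if "vector_field M X" "vector_field M Y" "vector_field M Z" for X Y Z
  proof -
    have "dir_deriv X (\<lambda>q. g q (Y q) (Z q)) p = g p (D' X Y p) (Z p) + g p (Y p) (D' X Z p)"
      if "levi_civita_connection M g D'" for D'
      using that \<open>vector_field M X\<close> \<open>vector_field M Y\<close> \<open>vector_field M Z\<close> p
      unfolding levi_civita_connection_def by blast
    from this[OF D] this[OF levi_civita_nabla]
    have "g p (D X Y p) (Z p) + g p (Y p) (D X Z p) =
          g p (nabla X Y p) (Z p) + g p (Y p) (nabla X Z p)" by linarith
    then show ?thesis
      by (simp add: bilinear_lsub[OF g_bilinear] g_sym[of p "Y p"] algebra_simps)
  qed
  obtain Z where Z: "vector_field M Z" "Z p = ?S X Y"
    using field_extension[OF p tan[OF X Y]] by blast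
  have "g p (?S X Y) (Z p) = - g p (?S X Y) (Z p)"
    using sym skew X Y Z(1) by metis
  then have "g p (?S X Y) (?S X Y) = 0"
    unfolding Z(2) by simp
  then show ?thesis
    using g_pos[OF p tan[OF X Y]] by force
qed

text \<open>The second derivatives of \<open>Z\<close> cancel by symmetry, and all terms with first
  derivatives of the fields cancel against each other or against the bracket term. What is left
  depends on values at \<open>p\<close> only.\<close>

lemma riemann_curvature_eq:
  assumes D: "levi_civita_connection M g D"
    and X: "vector_field M X" and Y: "vector_field M Y" and Z: "vector_field M Z" and p: "p \<in> M"
  shows "riemann_curvature D X Y Z p = curv p (X p) (Y p) (Z p)"
proof -
  let ?d = "\<lambda>f. frechet_derivative f (at p)"
  note Dvf = levi_civita_vector_field[OF D]
  have DD: "D X (D Y Z) p = second_derivative Z p (Y p) (X p) + ?d Z (?d Y (X p)) +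
      d\<Gamma> p (X p) (Y p) (Z p) + \<Gamma> p (?d Y (X p)) (Z p) + \<Gamma> p (Y p) (?d Z (X p)) +
      \<Gamma> p (X p) (?d Z (Y p)) + \<Gamma> p (X p) (\<Gamma> p (Y p) (Z p))"
    if X: "vector_field M X" and Y: "vector_field M Y" for X Y
  proof -
    obtain U where U: "M \<subseteq> U" "smooth_on U Y" "smooth_on U Z"
      using smooth_near_Int vector_fieldD(1) Y Z by metis
    have dn: "(nabla Y Z has_derivative (\<lambda>v. second_derivative Z p (Y p) v + ?d Z (?d Y v) +
        (d\<Gamma> p v (Y p) (Z p) + \<Gamma> p (?d Y v) (Z p) + \<Gamma> p (Y p) (?d Z v)))) (at p)"
      unfolding nabla_def[abs_def]
      using U p by (intro has_derivative_add has_derivative_dir_deriv[where S = U] \<Gamma>_has_derivative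
          vector_fieldD(3)[OF Y p] vector_fieldD(3)[OF Z p]) auto
    have eq: "D Y Z q = nabla Y Z q" if "q \<in> M" for q
      using levi_civita_unique[OF D Y Z that] .
    have "D X (D Y Z) p = nabla X (D Y Z) p"
      by (rule levi_civita_unique[OF D X Dvf[OF Y Z] p])
    also have "\<dots> = ?d (D Y Z) (X p) + \<Gamma> p (X p) (nabla Y Z p)"
      by (simp add: nabla_def[of X] dir_deriv_def eq[OF p])
    \<comment> \<open>\<open>D Y Z\<close> is known to agree with \<open>nabla Y Z\<close> on
      \<open>M\<close> only; as \<open>X p\<close> is tangent, this suffices to exchange their
      derivatives.\<close>
    also have "?d (D Y Z) (X p) = second_derivative Z p (Y p) (X p) + ?d Z (?d Y (X p)) +
        (d\<Gamma> p (X p) (Y p) (Z p) + \<Gamma> p (?d Y (X p)) (Z p) + \<Gamma> p (Y p) (?d Z (X p)))"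
      using derivative_along_tangent_cong[OF vector_fieldD(3)[OF Dvf[OF Y Z] p] dn eq
          vector_fieldD(2)[OF X p]] .
    finally show ?thesis
      by (simp add: nabla_def dir_deriv_def bilinear_radd[OF \<Gamma>_bilinear])
  qed
  have "lie_bracket X Y q \<in> tangent_space M q" if "q \<in> M" for q
    unfolding levi_civita_torsion[OF D X Y that, symmetric]
    using that by (intro subspace_diff[OF subspace_tangent] vector_fieldD(2) Dvf X Y)
  moreover have "smooth_near M (lie_bracket X Y)"
    unfolding lie_bracket_def[abs_def]
    by (intro smooth_near_diff smooth_near_dir_deriv vector_fieldD(1) X Y)
  ultimately have br: "vector_field M (lie_bracket X Y)"
    unfolding vector_field_def by blast
  have "D (lie_bracket X Y) Z p = nabla (lie_bracket X Y) Z p"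
    by (rule levi_civita_unique[OF D br Z p])
  also have "\<dots> = ?d Z (?d Y (X p)) - ?d Z (?d X (Y p)) +
      \<Gamma> p (?d Y (X p)) (Z p) - \<Gamma> p (?d X (Y p)) (Z p)"
    using has_derivative_linear[OF vector_fieldD(3)[OF Z p]]
    by (simp add: nabla_def dir_deriv_def lie_bracket_def linear_diff bilinear_lsub[OF \<Gamma>_bilinear])
  finally have L: "D (lie_bracket X Y) Z p = \<dots>" .
  obtain U where "M \<subseteq> U" "smooth_on U Z"
    using vector_fieldD(1)[OF Z] unfolding smooth_near_def by blast
  then have "second_derivative Z p (Y p) (X p) = second_derivative Z p (X p) (Y p)"
    using p by (intro second_derivative_commute[where S = U]) auto
  then show ?thesis
    unfolding riemann_curvature_def curv_def DD[OF X Y] DD[OF Y X] L by (simp add: algebra_simps)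
qed

text \<open>For existence a basis of the section is extended to fields and \<open>nabla\<close> is
  the connection; for uniqueness every admissible triple yields an instance of the formula in
  \<open>k\<close>. Hence the premise speaks of all spanning pairs rather than one basis.\<close>

lemma sectional_curvature_eqI:
  assumes p: "p \<in> M" and \<sigma>: "\<sigma> \<in> tangent_sections M p"
    and k: "\<And>x y. span {x, y} = \<sigma> \<Longrightarrow>
       g p (curv p x y y) x / (g p x x * g p y y - (g p x y)\<^sup>2) = k"
  shows "sectional_curvature M g p \<sigma> = k"
proof -
  obtain B where B: "B \<subseteq> \<sigma>" "independent B" "\<sigma> \<subseteq> span B" "card B = 2"
    using basis_exists[of \<sigma>] \<sigma> unfolding tangent_sections_def by auto
  then obtain x y where xy: "B = {x, y}"
    by (auto simp: card_2_iff)
  have sp: "span {x, y} = \<sigma>"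
    using B \<sigma> xy span_minimal unfolding tangent_sections_def by blast
  obtain X Y where XY: "vector_field M X" "X p = x" "vector_field M Y" "Y p = y"
    using field_extension[OF p, of x] field_extension[OF p, of y] B(1) \<sigma>
    unfolding tangent_sections_def xy by blast
  show ?thesis
    unfolding sectional_curvature_def
  proof (rule the_equality)
    show "\<exists>D X Y. levi_civita_connection M g D \<and> vector_field M X \<and> vector_field M Y \<and>
       span {X p, Y p} = \<sigma> \<and>
       k = g p (riemann_curvature D X Y Y p) (X p) /
           (g p (X p) (X p) * g p (Y p) (Y p) - (g p (X p) (Y p))\<^sup>2)"
      using XY sp k[OF sp] riemann_curvature_eq[OF levi_civita_nabla XY(1,3,3) p]
      by (intro exI[of _ nabla] exI[of _ X] exI[of _ Y]) (auto simp: levi_civita_nabla)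
  next
    fix k' assume "\<exists>D X Y. levi_civita_connection M g D \<and> vector_field M X \<and> vector_field M Y \<and>
       span {X p, Y p} = \<sigma> \<and>
       k' = g p (riemann_curvature D X Y Y p) (X p) /
           (g p (X p) (X p) * g p (Y p) (Y p) - (g p (X p) (Y p))\<^sup>2)"
    then show "k' = k"
      using riemann_curvature_eq p k by metis
  qed
qed

end

section \<open>The Stiefel manifold of orthonormal pairs\<close>

definition of_columns :: "real^'n \<Rightarrow> real^'n \<Rightarrow> real^2^'n" where
  "of_columns a b = (\<chi> i. vector [a $ i, b $ i])"

lemma column_of_columns [simp]:
  "column 1 (of_columns a b) = a" "column 2 (of_columns a b) = b"
  by (simp_all add: of_columns_def column_def vec_eq_iff)

lemma column_simps [simp]:
  fixes x y :: "real^2^'n"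
  shows "column j (x + y) = column j x + column j y" "column j (x - y) = column j x - column j y"
    "column j (- x) = - column j x" "column j (r *\<^sub>R x) = r *\<^sub>R column j x"
    "column j (0 :: real^2^'n) = 0"
  by (simp_all add: column_def vec_eq_iff)

lemma columns_eqI:
  "column 1 x = column 1 y \<Longrightarrow> column 2 x = column 2 y \<Longrightarrow> x = (y :: real^2^'n)"
  by (simp add: column_def vec_eq_iff forall_2)

lemma of_columns_column [simp]: "of_columns (column 1 x) (column 2 x) = x"
  by (rule columns_eqI) simp_all

lemma inner_columns:
  fixes x y :: "real^2^'n::finite"
  shows "x \<bullet> y = column 1 x \<bullet> column 1 y + column 2 x \<bullet> column 2 y"
  by (simp add: inner_vec_def column_def sum_2 sum.distrib)

text \<open>With the identity, the three operations form a basis of the right multiplications by 2x2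
  matrices. Matrix products become inner products of images under them, and the relations below
  normalize such expressions.\<close>

definition colrot :: "real^2^'n \<Rightarrow> real^2^'n" where
  "colrot x = of_columns (- column 2 x) (column 1 x)"

definition colneg :: "real^2^'n \<Rightarrow> real^2^'n" where
  "colneg x = of_columns (column 1 x) (- column 2 x)"

definition colswap :: "real^2^'n \<Rightarrow> real^2^'n" where
  "colswap x = of_columns (column 2 x) (column 1 x)"

lemmas colop_defs = colrot_def colneg_def colswap_def

lemma colop_linear [simp]:
  "colrot (x + y) = colrot x + colrot y" "colrot (x - y) = colrot x - colrot y"
  "colrot (- x) = - colrot x" "colrot (r *\<^sub>R x) = r *\<^sub>R colrot x"
  "colneg (x + y) = colneg x + colneg y" "colneg (x - y) = colneg x - colneg y"
  "colneg (- x) = - colneg x" "colneg (r *\<^sub>R x) = r *\<^sub>R colneg x"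
  "colswap (x + y) = colswap x + colswap y" "colswap (x - y) = colswap x - colswap y"
  "colswap (- x) = - colswap x" "colswap (r *\<^sub>R x) = r *\<^sub>R colswap x"
  by (rule columns_eqI; simp add: colop_defs)+

lemma colop_comp [simp]:
  "colrot (colrot x) = - x" "colneg (colneg x) = x" "colswap (colswap x) = x"
  "colneg (colswap x) = - colrot x" "colswap (colneg x) = colrot x"
  "colrot (colneg x) = colswap x" "colneg (colrot x) = - colswap x"
  "colrot (colswap x) = - colneg x" "colswap (colrot x) = colneg x"
  by (rule columns_eqI; simp add: colop_defs)+

lemma colop_adjoint:
  fixes x y :: "real^2^'n::finite"
  shows "colrot x \<bullet> y = - (x \<bullet> colrot y)" "colneg x \<bullet> y = x \<bullet> colneg y"
    "colswap x \<bullet> y = x \<bullet> colswap y"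
  by (simp_all add: inner_columns colop_defs)

lemma colrot_inner_self [simp]:
  fixes x :: "real^2^'n::finite"
  shows "colrot x \<bullet> x = 0" "x \<bullet> colrot x = 0"
  by (simp_all add: inner_columns colop_defs inner_commute)

lemma bounded_linear_colop:
  "bounded_linear (colrot :: real^2^'n::finite \<Rightarrow> _)"
  "bounded_linear (colneg :: real^2^'n::finite \<Rightarrow> _)"
  "bounded_linear (colswap :: real^2^'n::finite \<Rightarrow> _)"
  by (intro linear_conv_bounded_linear[THEN iffD1] linearI; simp)+

lemma bounded_linear_of_columns:
  "bounded_linear (\<lambda>a :: real^'n::finite. of_columns a 0)"
  "bounded_linear (\<lambda>a :: real^'n::finite. of_columns 0 a)"
  by (intro linear_conv_bounded_linear[THEN iffD1] linearI columns_eqI; simp)+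

lemma stiefel2_iff_columns:
  fixes Y :: "real^2^'n::finite"
  shows "Y \<in> stiefel2 \<longleftrightarrow> column 1 Y \<bullet> column 1 Y = 1 \<and> column 2 Y \<bullet> column 2 Y = 1 \<and>
     column 1 Y \<bullet> column 2 Y = 0"
  by (auto simp: stiefel2_def vec_eq_iff forall_2 matrix_matrix_mult_def transpose_def mat_def
      column_def inner_vec_def mult.commute)

text \<open>\<open>transpose Y ** Y\<close> is symmetric, so it is determined by its inner products
  with the identity and the two traceless symmetric matrices.\<close>

lemma stiefel2_iff:
  fixes Y :: "real^2^'n::finite"
  shows "Y \<in> stiefel2 \<longleftrightarrow> Y \<bullet> Y = 2 \<and> colneg Y \<bullet> Y = 0 \<and> colswap Y \<bullet> Y = 0"
  unfolding stiefel2_iff_columns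
  by (auto simp: inner_columns colop_defs inner_commute)

text \<open>\<open>transpose Y ** x\<close> is expanded in the orthogonal basis given by the
  identity and the matrices behind the column operations. Each has squared norm 2, whence the
  denominator.\<close>

lemma stiefel_metric_eq:
  fixes Y x y :: "real^2^'n::finite"
  shows "stiefel_metric \<alpha> Y x y = x \<bullet> y + (\<alpha> - 1) / 2 * ((Y \<bullet> x) * (Y \<bullet> y) +
     (colrot Y \<bullet> x) * (colrot Y \<bullet> y) + (colneg Y \<bullet> x) * (colneg Y \<bullet> y) +
     (colswap Y \<bullet> x) * (colswap Y \<bullet> y))"
proof -
  have tr: "trace (transpose a ** b) = column 1 a \<bullet> column 1 b + column 2 a \<bullet> column 2 b"
    for a b :: "real^2^'n"
    by (simp add: trace_def matrix_matrix_mult_def transpose_def column_def inner_vec_def sum_2)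
  have ent: "(transpose a ** b) $ i $ j = column i a \<bullet> column j b" for a b :: "real^2^'n" and i j
    by (simp add: matrix_matrix_mult_def transpose_def column_def inner_vec_def)
  have "trace (transpose x ** Y ** transpose Y ** y) =
      trace ((transpose x ** Y) ** (transpose Y ** y))"
    by (simp add: matrix_mul_assoc)
  also have "\<dots> = (\<Sum>i\<in>UNIV. \<Sum>k\<in>UNIV. (column i x \<bullet> column k Y) * (column k Y \<bullet> column i y))"
    unfolding trace_def matrix_matrix_mult_def[of "transpose x ** Y"] by (simp add: ent)
  finally show ?thesis
    unfolding stiefel_metric_def tr
    by (simp add: sum_2 inner_columns colop_defs inner_commute[of "column _ Y" "column _ x"] field_simps)
qed

section \<open>Tangent spaces of the Stiefel manifold\<close>

text \<open>The squared length has derivative 0 at 0 because \<open>w\<close> is orthogonal to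
  \<open>u 0\<close>, so dividing by the length changes neither position nor velocity there.\<close>

lemma normalized_curve:
  fixes u :: "real \<Rightarrow> 'b::real_inner"
  assumes u: "smooth_on S u" "\<And>t. t \<in> S \<Longrightarrow> u t \<noteq> 0" "0 \<in> S"
    and w: "(u has_vector_derivative w) (at 0)" "u 0 \<bullet> u 0 = 1" "u 0 \<bullet> w = 0"
  defines "n \<equiv> \<lambda>t. (u t \<bullet> u t) powr (-1/2) *\<^sub>R u t"
  shows "smooth_on S n" "(n has_vector_derivative w) (at 0)" "n 0 = u 0"
    "t \<in> S \<Longrightarrow> n t \<bullet> n t = 1"
proof -
  show "smooth_on S n"
    unfolding n_def using u by (intro smooth_on_scaleR smooth_on_powr smooth_on_inner) auto
  show "n 0 = u 0" by (simp add: n_def w)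
  show "n t \<bullet> n t = 1" if "t \<in> S"
  proof -
    have "u t \<bullet> u t > 0" using u(2)[OF that] by simp
    then have "(u t \<bullet> u t) powr (-1/2) * (u t \<bullet> u t) powr (-1/2) * (u t \<bullet> u t) = 1"
      by (simp flip: powr_add add: powr_neg_one)
    then show ?thesis by (simp add: n_def mult_ac)
  qed
  have "((\<lambda>t. u t \<bullet> u t) has_derivative (\<lambda>h. u 0 \<bullet> (h *\<^sub>R w) + (h *\<^sub>R w) \<bullet> u 0)) (at 0)"
    using w(1) unfolding has_vector_derivative_def by (intro has_derivative_inner)
  then have "((\<lambda>t. u t \<bullet> u t) has_real_derivative 0) (at 0)"
    using w(3) unfolding has_field_derivative_def by (simp add: inner_commute[of w] lambda_zero)
  then have "((\<lambda>t. (u t \<bullet> u t) powr (-1/2)) has_real_derivative 0) (at 0)"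
    using DERIV_powr[of "\<lambda>t. u t \<bullet> u t" 0 0 "\<lambda>t. -1/2" 0] w(2) by simp
  from has_vector_derivative_scaleR[OF this w(1)] show "(n has_vector_derivative w) (at 0)"
    unfolding n_def by (simp add: w(2))
qed

text \<open>The curve through \<open>Y\<close> with velocity \<open>v\<close> is \<open>Y + t v\<close>, orthonormalized by Gram-Schmidt.\<close>

lemma tangent_space_stiefel2:
  fixes Y v :: "real^2^'n::finite"
  assumes Y: "Y \<in> stiefel2"
  shows "v \<in> tangent_space stiefel2 Y \<longleftrightarrow> Y \<bullet> v = 0 \<and> colneg Y \<bullet> v = 0 \<and> colswap Y \<bullet> v = 0"
proof
  assume v: "v \<in> tangent_space stiefel2 Y"
  \<comment> \<open>The constraints are quadratic forms of self-adjoint maps \<open>L\<close>;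
    differentiating such a form gives the factor 2.\<close>
  have *: "2 * (L Y \<bullet> v) = 0" if "bounded_linear L" "\<And>x y. L x \<bullet> y = x \<bullet> L y" "\<And>q. q \<in> stiefel2 \<Longrightarrow> L q \<bullet> q = r"
    for L :: "real^2^'n \<Rightarrow> real^2^'n" and r
  proof -
    have "((\<lambda>q. L q \<bullet> q) has_derivative (\<lambda>h. L Y \<bullet> h + L h \<bullet> Y)) (at Y)"
      by (intro has_derivative_inner bounded_linear.has_derivative[OF that(1)] has_derivative_ident)
    then have "L Y \<bullet> v + L v \<bullet> Y = 0"
      by (rule derivative_along_tangent_cong[where f = "\<lambda>q. L q \<bullet> q" and h = "\<lambda>q. r",
            OF _ has_derivative_const that(3) v])
    then show ?thesis using that(2)[of v Y] inner_commute[of v "L Y"] by simp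
  qed
  show "Y \<bullet> v = 0 \<and> colneg Y \<bullet> v = 0 \<and> colswap Y \<bullet> v = 0"
    using *[OF bounded_linear_ident, of 2] *[OF bounded_linear_colop(2) colop_adjoint(2), of 0]
      *[OF bounded_linear_colop(3) colop_adjoint(3), of 0]
    by (simp add: stiefel2_iff)
next
  let ?y = "\<lambda>j. column j Y" and ?v = "\<lambda>j. column j v"
  assume "Y \<bullet> v = 0 \<and> colneg Y \<bullet> v = 0 \<and> colswap Y \<bullet> v = 0"
  then have v: "?y 1 \<bullet> ?v 1 = 0" "?y 2 \<bullet> ?v 2 = 0" "?y 2 \<bullet> ?v 1 + ?y 1 \<bullet> ?v 2 = 0"
    by (auto simp: inner_columns colop_defs)
  have y: "?y 1 \<bullet> ?y 1 = 1" "?y 2 \<bullet> ?y 2 = 1" "?y 1 \<bullet> ?y 2 = 0"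
    using Y by (auto simp: stiefel2_iff_columns)
  have line: "smooth_on UNIV (\<lambda>t::real. a + t *\<^sub>R b)"
    "((\<lambda>t. a + t *\<^sub>R b) has_vector_derivative b) (at t)" for a b :: "real^'n" and t
    by (auto intro!: smooth_on_add smooth_on_scaleR smooth_on_const smooth_on_ident derivative_eq_intros)
  \<comment> \<open>The component along the unit vector \<open>?y 1\<close> is constantly 1, so the
    first column can be normalized for every \<open>t\<close>.\<close>
  have "?y 1 + t *\<^sub>R ?v 1 \<noteq> 0" for t
  proof
    assume "?y 1 + t *\<^sub>R ?v 1 = 0"
    then have "?y 1 \<bullet> (?y 1 + t *\<^sub>R ?v 1) = 0" by simp
    then show False using y v by (simp add: inner_add_right)
  qed
  then have u: "smooth_on UNIV (\<lambda>t. ?y 1 + t *\<^sub>R ?v 1)" "\<And>t. t \<in> UNIV \<Longrightarrow> ?y 1 + t *\<^sub>R ?v 1 \<noteq> 0"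
    "0 \<in> (UNIV :: real set)" "((\<lambda>t. ?y 1 + t *\<^sub>R ?v 1) has_vector_derivative ?v 1) (at 0)"
    "(?y 1 + 0 *\<^sub>R ?v 1) \<bullet> (?y 1 + 0 *\<^sub>R ?v 1) = 1" "(?y 1 + 0 *\<^sub>R ?v 1) \<bullet> ?v 1 = 0"
    using line y v by auto
  define n where "n = (\<lambda>t. ((?y 1 + t *\<^sub>R ?v 1) \<bullet> (?y 1 + t *\<^sub>R ?v 1)) powr (-1/2) *\<^sub>R (?y 1 + t *\<^sub>R ?v 1))"
  have n: "smooth_on UNIV n" "(n has_vector_derivative ?v 1) (at 0)" "n 0 = ?y 1"
    "n t \<bullet> n t = 1" for t
    using normalized_curve(1-3)[OF u] normalized_curve(4)[OF u, of t] unfolding n_def by auto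
  define b where "b = (\<lambda>t. (?y 2 + t *\<^sub>R ?v 2) - (n t \<bullet> (?y 2 + t *\<^sub>R ?v 2)) *\<^sub>R n t)"
  have b0: "b 0 = ?y 2" using y by (simp add: b_def n)
  have sb: "smooth_on UNIV b"
    unfolding b_def by (intro smooth_on_diff smooth_on_scaleR smooth_on_inner line n)
  have nb: "n t \<bullet> b t = 0" for t
    by (simp add: b_def inner_diff_right n)
  \<comment> \<open>The subtracted correction vanishes: \<open>?y 1\<close> and \<open>?y 2\<close>
    are orthogonal, and the coefficient of \<open>n 0\<close> is zero by the mixed tangency
    equation.\<close>
  have "(b has_vector_derivative ?v 2 - ((n 0 \<bullet> (?y 2 + 0 *\<^sub>R ?v 2)) *\<^sub>R ?v 1 +
      (n 0 \<bullet> ?v 2 + ?v 1 \<bullet> (?y 2 + 0 *\<^sub>R ?v 2)) *\<^sub>R n 0)) (at 0)"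
    unfolding b_def
    by (intro has_vector_derivative_diff has_vector_derivative_scaleR line
        bounded_bilinear.has_vector_derivative[OF bounded_bilinear_inner] n
        has_real_derivative_iff_has_vector_derivative[THEN iffD2])
  then have db: "(b has_vector_derivative ?v 2) (at 0)"
    using y v by (simp add: n inner_commute add.commute)
  \<comment> \<open>Only the second column can degenerate. It does not near 0, so the curve is
    restricted to an interval inside this open set.\<close>
  define S where "S = {t. b t \<noteq> 0}"
  have "continuous_on UNIV b"
    using sb unfolding smooth_on_def by (metis Ck_on.simps(1))
  then have oS: "open S" unfolding S_def
    by (intro open_Collect_neq continuous_on_const)
  have S0: "0 \<in> S" using y by (auto simp: S_def b0)
  have u: "\<And>t. t \<in> S \<Longrightarrow> b t \<noteq> 0" "b 0 \<bullet> b 0 = 1" "b 0 \<bullet> ?v 2 = 0"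
    using y v by (auto simp: S_def b0)
  define m where "m = (\<lambda>t. (b t \<bullet> b t) powr (-1/2) *\<^sub>R b t)"
  have m: "smooth_on S m" "(m has_vector_derivative ?v 2) (at 0)" "m 0 = ?y 2"
    "t \<in> S \<Longrightarrow> m t \<bullet> m t = 1" "n t \<bullet> m t = 0" for t
    using normalized_curve(1-3)[OF smooth_on_subset[OF sb oS] u(1) S0 db u(2,3)]
      normalized_curve(4)[OF smooth_on_subset[OF sb oS] u(1) S0 db u(2,3), of t]
    unfolding m_def by (auto simp: b0 nb)
  obtain e where e: "e > 0" "ball 0 e \<subseteq> S"
    using oS S0 open_contains_ball by blast
  define c where "c = (\<lambda>t. of_columns (n t) 0 + of_columns 0 (m t))"
  have c: "column 1 (c t) = n t" "column 2 (c t) = m t" for t by (simp_all add: c_def)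
  have sub: "{-e<..<e} \<subseteq> S" using e by (auto simp: ball_def dist_real_def subset_iff abs_less_iff)
  have "smooth_on {-e<..<e} c"
    unfolding c_def using sub
    by (intro smooth_on_add smooth_on_bounded_linear[OF bounded_linear_of_columns(1)]
        smooth_on_bounded_linear[OF bounded_linear_of_columns(2)]
        smooth_on_subset[OF n(1)] smooth_on_subset[OF m(1)]) simp_all
  moreover have "c ` {-e<..<e} \<subseteq> stiefel2"
    using sub n(4) m(4,5) by (auto simp: stiefel2_iff_columns c)
  moreover have "c 0 = Y"
    by (rule columns_eqI) (simp_all add: c n m)
  moreover have "(c has_vector_derivative of_columns (?v 1) 0 + of_columns 0 (?v 2)) (at 0)"
    unfolding c_def
    by (rule has_vector_derivative_add[OF
          bounded_linear.has_vector_derivative[OF bounded_linear_of_columns(1) n(2)]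
          bounded_linear.has_vector_derivative[OF bounded_linear_of_columns(2) m(2)]])
  moreover have "of_columns (?v 1) 0 + of_columns 0 (?v 2) = v"
    by (rule columns_eqI) simp_all
  ultimately show "v \<in> tangent_space stiefel2 Y"
    using e(1) unfolding tangent_space_def by auto
qed

text \<open>The coefficient of \<open>colrot Y\<close> in the decomposition of a tangent vector at \<open>Y\<close>.\<close>

definition stiefel_form :: "real^2^'n::finite \<Rightarrow> real^2^'n \<Rightarrow> real" where
  "stiefel_form Y x = (colrot Y \<bullet> x) / 2"

text \<open>
  The first three summands are minus the second fundamental form for the metric induced from the ambient
  space (\<open>\<alpha> = 1\<close>). The remaining ones correct it for the term \<open>2 (\<alpha> - 1) stiefel_form Y x * stiefel_form Y z\<close>
  that the metric has on tangent vectors in addition to \<open>x \<bullet> z\<close>; the multiple of \<open>Y\<close> makes the sum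
  tangential.
\<close>

definition stiefel_christoffel ::
    "real \<Rightarrow> real^2^'n::finite \<Rightarrow> real^2^'n \<Rightarrow> real^2^'n \<Rightarrow> real^2^'n" where
  "stiefel_christoffel \<alpha> Y x z =
     ((x \<bullet> z) / 2) *\<^sub>R Y + ((colneg x \<bullet> z) / 2) *\<^sub>R colneg Y + ((colswap x \<bullet> z) / 2) *\<^sub>R colswap Y
     + (\<alpha> - 1) *\<^sub>R (stiefel_form Y z *\<^sub>R colrot x + stiefel_form Y x *\<^sub>R colrot z
                + (2 * stiefel_form Y x * stiefel_form Y z) *\<^sub>R Y)"

definition stiefel_christoffel_deriv ::
    "real \<Rightarrow> real^2^'n::finite \<Rightarrow> real^2^'n \<Rightarrow> real^2^'n \<Rightarrow> real^2^'n \<Rightarrow> real^2^'n" where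
  "stiefel_christoffel_deriv \<alpha> Y v x z =
     ((x \<bullet> z) / 2) *\<^sub>R v + ((colneg x \<bullet> z) / 2) *\<^sub>R colneg v + ((colswap x \<bullet> z) / 2) *\<^sub>R colswap v
     + (\<alpha> - 1) *\<^sub>R (stiefel_form v z *\<^sub>R colrot x + stiefel_form v x *\<^sub>R colrot z
                + (2 * stiefel_form Y x * stiefel_form Y z) *\<^sub>R v
                + (2 * (stiefel_form v x * stiefel_form Y z + stiefel_form Y x * stiefel_form v z)) *\<^sub>R Y)"

lemma stiefel_form_linear [simp]:
  "stiefel_form Y (x + y) = stiefel_form Y x + stiefel_form Y y"
  "stiefel_form Y (r *\<^sub>R x) = r * stiefel_form Y x"
  "stiefel_form (x + y) z = stiefel_form x z + stiefel_form y z"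
  "stiefel_form (r *\<^sub>R x) z = r * stiefel_form x z"
  by (simp_all add: stiefel_form_def inner_add_right inner_add_left add_divide_distrib)

lemma bilinear_stiefel_christoffel: "bilinear (stiefel_christoffel \<alpha> Y)"
  unfolding bilinear_def stiefel_christoffel_def
  by (auto intro!: linearI simp: inner_add_left inner_add_right algebra_simps add_divide_distrib)

lemma stiefel_christoffel_commute: "stiefel_christoffel \<alpha> Y x z = stiefel_christoffel \<alpha> Y z x"
proof -
  have "colneg z \<bullet> x = colneg x \<bullet> z" "colswap z \<bullet> x = colswap x \<bullet> z"
    by (metis colop_adjoint(2) inner_commute) (metis colop_adjoint(3) inner_commute)
  then show ?thesis
    by (simp add: stiefel_christoffel_def inner_commute[of z] algebra_simps)
qed

lemma smooth_on_stiefel_christoffel: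
  assumes "smooth_on U X" "smooth_on U Z"
  shows "smooth_on U (\<lambda>q. stiefel_christoffel \<alpha> q (X q) (Z q))"
proof -
  have [simp]: "open U" using assms by (simp add: smooth_on_def)
  show ?thesis
    unfolding stiefel_christoffel_def stiefel_form_def
    using assms
    by (intro smooth_on_add smooth_on_scaleR smooth_on_mult smooth_on_inner smooth_on_const
        smooth_on_ident smooth_on_bounded_linear[OF bounded_linear_divide]
        smooth_on_bounded_linear[OF bounded_linear_colop(1)]
        smooth_on_bounded_linear[OF bounded_linear_colop(2)]
        smooth_on_bounded_linear[OF bounded_linear_colop(3)]) auto
qed

lemmas has_derivative_colop [derivative_intros] =
  bounded_linear.has_derivative[OF bounded_linear_colop(1)]
  bounded_linear.has_derivative[OF bounded_linear_colop(2)]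
  bounded_linear.has_derivative[OF bounded_linear_colop(3)]

lemma has_derivative_stiefel_form [derivative_intros]:
  assumes "(X has_derivative X') (at p)"
  shows "((\<lambda>q. stiefel_form q (X q)) has_derivative
    (\<lambda>v. stiefel_form v (X p) + stiefel_form p (X' v))) (at p)"
  unfolding stiefel_form_def
  by (auto intro!: derivative_eq_intros assms simp: fun_eq_iff add_divide_distrib)

lemma has_derivative_stiefel_christoffel:
  assumes "(X has_derivative X') (at p)" "(Z has_derivative Z') (at p)"
  shows "((\<lambda>q. stiefel_christoffel \<alpha> q (X q) (Z q)) has_derivative
    (\<lambda>v. stiefel_christoffel_deriv \<alpha> p v (X p) (Z p) + stiefel_christoffel \<alpha> p (X' v) (Z p)
       + stiefel_christoffel \<alpha> p (X p) (Z' v))) (at p)"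
  unfolding stiefel_christoffel_def
  by (auto intro!: derivative_eq_intros assms simp: stiefel_christoffel_deriv_def
      fun_eq_iff algebra_simps inner_commute add_divide_distrib)

section \<open>The metric and its Levi-Civita connection\<close>

lemma stiefel2_inner:
  assumes "Y \<in> stiefel2"
  shows "Y \<bullet> Y = 2" "colneg Y \<bullet> Y = 0" "Y \<bullet> colneg Y = 0" "colswap Y \<bullet> Y = 0" "Y \<bullet> colswap Y = 0"
    "colrot Y \<bullet> colrot Y = 2" "colneg Y \<bullet> colneg Y = 2" "colswap Y \<bullet> colswap Y = 2"
    "colrot Y \<bullet> colneg Y = 0" "colneg Y \<bullet> colrot Y = 0"
    "colrot Y \<bullet> colswap Y = 0" "colswap Y \<bullet> colrot Y = 0"
    "colswap Y \<bullet> colneg Y = 0" "colneg Y \<bullet> colswap Y = 0"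
  using assms by (simp_all add: stiefel2_iff colop_adjoint[of Y])

lemma bilinear_stiefel_metric: "bilinear (stiefel_metric \<alpha> Y)"
  unfolding bilinear_def
  by (auto intro!: linearI simp: stiefel_metric_eq inner_add_left inner_add_right algebra_simps
      add_divide_distrib diff_divide_distrib)

lemma stiefel_metric_commute: "stiefel_metric \<alpha> Y x y = stiefel_metric \<alpha> Y y x"
  by (simp add: stiefel_metric_eq inner_commute[of x] mult.commute)

lemma stiefel_metric_tangent:
  assumes "Y \<in> stiefel2" "x \<in> tangent_space stiefel2 Y"
  shows "stiefel_metric \<alpha> Y v x = v \<bullet> x + 2 * (\<alpha> - 1) * stiefel_form Y v * stiefel_form Y x"
  using tangent_space_stiefel2[OF assms(1), of x] assms(2)
  by (simp add: stiefel_metric_eq stiefel_form_def)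

text \<open>Cauchy-Schwarz against \<open>colrot Y\<close>, of squared length 2, makes the squared
  horizontal length \<open>v \<bullet> v - 2 * (stiefel_form Y v)^2\<close> nonnegative. The metric
  adds \<alpha> times the vertical part, and the two cannot vanish together.\<close>

lemma stiefel_metric_pos:
  assumes "\<alpha> > 0" "Y \<in> stiefel2" "v \<in> tangent_space stiefel2 Y" "v \<noteq> 0"
  shows "stiefel_metric \<alpha> Y v v > 0"
proof -
  have "(colrot Y \<bullet> v)\<^sup>2 \<le> 2 * (v \<bullet> v)"
    using Cauchy_Schwarz_ineq[of "colrot Y" v] stiefel2_inner[OF assms(2)] by simp
  then have "2 * (stiefel_form Y v)\<^sup>2 \<le> v \<bullet> v"
    by (simp add: stiefel_form_def power_divide)
  moreover have "v \<bullet> v > 0" using assms(4) by simp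
  ultimately have "\<alpha> * (v \<bullet> v) > 0" and
    "v \<bullet> v - 2 * (stiefel_form Y v)\<^sup>2 \<ge> 0" and "\<alpha> * (2 * (stiefel_form Y v)\<^sup>2) \<ge> 0"
    using assms(1) by auto
  moreover have "v \<bullet> v + 2 * (\<alpha> - 1) * stiefel_form Y v * stiefel_form Y v =
      (v \<bullet> v - 2 * (stiefel_form Y v)\<^sup>2) + \<alpha> * (2 * (stiefel_form Y v)\<^sup>2)"
    by (simp add: power2_eq_square algebra_simps)
  moreover have "v \<bullet> v - 2 * (stiefel_form Y v)\<^sup>2 > 0" if "stiefel_form Y v = 0"
    using that \<open>v \<bullet> v > 0\<close> by simp
  moreover have "\<alpha> * (2 * (stiefel_form Y v)\<^sup>2) > 0" if "stiefel_form Y v \<noteq> 0"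
    using that assms(1) by simp
  ultimately have "v \<bullet> v + 2 * (\<alpha> - 1) * stiefel_form Y v * stiefel_form Y v > 0"
    by (metis add_nonneg_pos add_pos_nonneg)
  then show ?thesis
    using stiefel_metric_tangent[OF assms(2,3)] by simp
qed

text \<open>The fixed vector \<open>v\<close> is projected onto the tangent space at the moving
  point \<open>q\<close>, whose three normal directions are orthogonal of squared length 2. The
  formula is polynomial in \<open>q\<close>, hence smooth everywhere.\<close>

lemma stiefel2_field_extension:
  fixes Y v :: "real^2^'n::finite"
  assumes Y: "Y \<in> stiefel2" and v: "v \<in> tangent_space stiefel2 Y"
  shows "\<exists>X. vector_field stiefel2 X \<and> X Y = v"
proof -
  define X where "X = (\<lambda>q. v - ((q \<bullet> v) / 2) *\<^sub>R q - ((colneg q \<bullet> v) / 2) *\<^sub>R colneg q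
     - ((colswap q \<bullet> v) / 2) *\<^sub>R colswap q)"
  have "smooth_on UNIV X"
    unfolding X_def
    by (intro smooth_on_diff smooth_on_scaleR smooth_on_inner smooth_on_const
        smooth_on_ident smooth_on_bounded_linear[OF bounded_linear_divide]
        smooth_on_bounded_linear[OF bounded_linear_colop(2)]
        smooth_on_bounded_linear[OF bounded_linear_colop(3)]) auto
  moreover have "X q \<in> tangent_space stiefel2 q" if "q \<in> stiefel2" for q
    unfolding tangent_space_stiefel2[OF that] X_def
    by (simp add: inner_diff_right stiefel2_inner[OF that])
  moreover have "X Y = v"
    using v unfolding tangent_space_stiefel2[OF Y] by (simp add: X_def)
  ultimately show ?thesis
    unfolding vector_field_def smooth_near_def by (intro exI[of _ X]) auto
qed

text \<open>Differentiating \<open>q \<bullet> Z q = 0\<close> and its two analogues along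
  \<open>X\<close> gives the normal components of \<open>dir_deriv X Z p\<close>, which the first
  three summands of the Christoffel expression cancel. In the rest, the \<open>colrot\<close> terms
  are normal along the base point only, balanced by its explicit multiple.\<close>

lemma stiefel_christoffel_tangential:
  fixes X Z :: "real^2^'n::finite \<Rightarrow> real^2^'n"
  assumes X: "vector_field stiefel2 X" and Z: "vector_field stiefel2 Z" and p: "p \<in> stiefel2"
  shows "dir_deriv X Z p + stiefel_christoffel \<alpha> p (X p) (Z p) \<in> tangent_space stiefel2 p"
proof -
  have dZ: "(Z has_derivative frechet_derivative Z (at p)) (at p)"
    using Z p smooth_near_has_derivative unfolding vector_field_def by blast
  have tX: "X p \<in> tangent_space stiefel2 p" and tZ: "Z p \<in> tangent_space stiefel2 p"
    using X Z p unfolding vector_field_def by auto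
  have *: "L p \<bullet> dir_deriv X Z p = - (L (X p) \<bullet> Z p)"
    if "bounded_linear L" "\<And>q. q \<in> stiefel2 \<Longrightarrow> L q \<bullet> Z q = 0" for L :: "real^2^'n \<Rightarrow> real^2^'n"
  proof -
    have "((\<lambda>q. L q \<bullet> Z q) has_derivative (\<lambda>h. L p \<bullet> frechet_derivative Z (at p) h + L h \<bullet> Z p)) (at p)"
      by (intro has_derivative_inner bounded_linear.has_derivative[OF that(1)] has_derivative_ident dZ)
    then have "L p \<bullet> frechet_derivative Z (at p) (X p) + L (X p) \<bullet> Z p = 0"
      by (rule derivative_along_tangent_cong[where f = "\<lambda>q. L q \<bullet> Z q" and h = "\<lambda>q. 0",
            OF _ has_derivative_const that(2) tX])
    then show ?thesis by (simp add: dir_deriv_def)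
  qed
  have tq: "q \<bullet> Z q = 0" "colneg q \<bullet> Z q = 0" "colswap q \<bullet> Z q = 0" if "q \<in> stiefel2" for q
    using Z that tangent_space_stiefel2[OF that] unfolding vector_field_def by auto
  note d = *[OF bounded_linear_ident tq(1)] *[OF bounded_linear_colop(2) tq(2)]
    *[OF bounded_linear_colop(3) tq(3)]
  have adj: "p \<bullet> colrot v = - (2 * stiefel_form p v)" "colneg p \<bullet> colrot v = - (colswap p \<bullet> v)"
    "colswap p \<bullet> colrot v = colneg p \<bullet> v" for v
    using colop_adjoint(1)[of p v] colop_adjoint(1)[of "colneg p" v] colop_adjoint(1)[of "colswap p" v]
    by (simp_all add: stiefel_form_def)
  show ?thesis
    using tX tZ unfolding tangent_space_stiefel2[OF p]
    by (simp add: inner_add_right d adj stiefel2_inner[OF p] stiefel_christoffel_def algebra_simps)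
qed

text \<open>The normal summands are orthogonal to \<open>z\<close> and \<open>stiefel_form\<close>
  vanishes on the whole value, so only the ambient inner product with the two \<open>colrot\<close>
  terms survives.\<close>

lemma stiefel_christoffel_metric:
  assumes p: "p \<in> stiefel2" and tx: "x \<in> tangent_space stiefel2 p"
    and ty: "y \<in> tangent_space stiefel2 p" and tz: "z \<in> tangent_space stiefel2 p"
  shows "stiefel_metric \<alpha> p (stiefel_christoffel \<alpha> p x y) z =
    (\<alpha> - 1) * (stiefel_form p y * (colrot x \<bullet> z) + stiefel_form p x * (colrot y \<bullet> z))"
proof -
  have "stiefel_form p (colrot v) = 0" if "v \<in> tangent_space stiefel2 p" for v
    using that colop_adjoint(1)[of p "colrot v"]
    unfolding tangent_space_stiefel2[OF p] stiefel_form_def by simp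
  moreover have "stiefel_form p p = 0" "stiefel_form p (colneg p) = 0" "stiefel_form p (colswap p) = 0"
    by (simp_all add: stiefel_form_def stiefel2_inner[OF p])
  ultimately have "stiefel_form p (stiefel_christoffel \<alpha> p x y) = 0"
    using tx ty by (simp add: stiefel_christoffel_def)
  then show ?thesis
    using tz unfolding stiefel_metric_tangent[OF p tz] tangent_space_stiefel2[OF p]
    by (simp add: stiefel_christoffel_def inner_add_left)
qed

text \<open>The \<open>colrot\<close> contributions weighted by \<open>stiefel_form p (X p)\<close>
  cancel because \<open>colrot\<close> is skew; the others match the derivative of the metric in its
  base point.\<close>

lemma stiefel_christoffel_compatible:
  fixes X Y Z :: "real^2^'n::finite \<Rightarrow> real^2^'n"
  assumes X: "vector_field stiefel2 X" and Y: "vector_field stiefel2 Y"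
    and Z: "vector_field stiefel2 Z" and p: "p \<in> stiefel2"
  shows "dir_deriv X (\<lambda>q. stiefel_metric \<alpha> q (Y q) (Z q)) p =
     stiefel_metric \<alpha> p (dir_deriv X Y p + stiefel_christoffel \<alpha> p (X p) (Y p)) (Z p) +
     stiefel_metric \<alpha> p (Y p) (dir_deriv X Z p + stiefel_christoffel \<alpha> p (X p) (Z p))"
proof -
  have dY: "(Y has_derivative frechet_derivative Y (at p)) (at p)"
    and dZ: "(Z has_derivative frechet_derivative Z (at p)) (at p)"
    using Y Z p smooth_near_has_derivative unfolding vector_field_def by blast+
  have tX: "X p \<in> tangent_space stiefel2 p" and tY: "Y p \<in> tangent_space stiefel2 p"
    and tZ: "Z p \<in> tangent_space stiefel2 p"
    using X Y Z p unfolding vector_field_def by auto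
  have *: "stiefel_metric \<alpha> p (D + stiefel_christoffel \<alpha> p (X p) V) W =
      D \<bullet> W + 2 * (\<alpha> - 1) * stiefel_form p D * stiefel_form p W +
      (\<alpha> - 1) * (stiefel_form p V * (colrot (X p) \<bullet> W) + stiefel_form p (X p) * (colrot V \<bullet> W))"
    if "V \<in> tangent_space stiefel2 p" "W \<in> tangent_space stiefel2 p" for D V W
    by (simp only: bilinear_ladd[OF bilinear_stiefel_metric] stiefel_metric_tangent[OF p that(2), of \<alpha> D]
        stiefel_christoffel_metric[OF p tX that])
  \<comment> \<open>For tangent fields the other three products in the metric have both factors zero
    at \<open>p\<close>, so the product rule removes them.\<close>
  have "((\<lambda>q. stiefel_metric \<alpha> q (Y q) (Z q)) has_derivative
     (\<lambda>h. Y p \<bullet> frechet_derivative Z (at p) h + frechet_derivative Y (at p) h \<bullet> Z p +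
       (\<alpha> - 1) / 2 *
       ((colrot h \<bullet> Y p + colrot p \<bullet> frechet_derivative Y (at p) h) * (colrot p \<bullet> Z p) +
        (colrot p \<bullet> Y p) * (colrot h \<bullet> Z p + colrot p \<bullet> frechet_derivative Z (at p) h)))) (at p)"
    using tY tZ unfolding stiefel_metric_eq tangent_space_stiefel2[OF p]
    by (auto intro!: derivative_eq_intros dY dZ simp: fun_eq_iff field_simps)
  then have "dir_deriv X (\<lambda>q. stiefel_metric \<alpha> q (Y q) (Z q)) p =
      Y p \<bullet> dir_deriv X Z p + dir_deriv X Y p \<bullet> Z p + (\<alpha> - 1) / 2 *
       ((colrot (X p) \<bullet> Y p + colrot p \<bullet> dir_deriv X Y p) * (colrot p \<bullet> Z p) +
        (colrot p \<bullet> Y p) * (colrot (X p) \<bullet> Z p + colrot p \<bullet> dir_deriv X Z p))"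
    unfolding dir_deriv_def by (simp add: frechet_derivative_eqI)
  moreover have "colrot (Z p) \<bullet> Y p = - (colrot (Y p) \<bullet> Z p)"
    using colop_adjoint(1)[of "Z p" "Y p"] inner_commute[of "Z p"] by simp
  ultimately show ?thesis
    unfolding stiefel_metric_commute[of \<alpha> p "Y p"] *[OF tY tZ] *[OF tZ tY]
    by (simp add: stiefel_form_def inner_commute[of "Y p"] field_simps)
qed

lemma christoffel_stiefel2:
  assumes "\<alpha> > 0"
  shows "christoffel (stiefel2 :: (real^2^'n::finite) set) (stiefel_metric \<alpha>)
    (stiefel_christoffel \<alpha>) (stiefel_christoffel_deriv \<alpha>)"
proof (rule christoffel.intro)
  fix p :: "real^2^'n" assume p: "p \<in> stiefel2"
  show "subspace (tangent_space stiefel2 p)"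
    by (auto simp: subspace_def tangent_space_stiefel2[OF p] inner_add_right)
qed (erule (1) stiefel_christoffel_tangential stiefel_christoffel_compatible, assumption+ |
    rule bilinear_stiefel_metric stiefel_metric_commute stiefel_metric_pos[OF assms]
      stiefel2_field_extension bilinear_stiefel_christoffel stiefel_christoffel_commute
      smooth_on_stiefel_christoffel has_derivative_stiefel_christoffel; assumption)+

section \<open>The curvature in terms of horizontal components\<close>

lemma stiefel_form_colop:
  assumes Y: "Y \<in> stiefel2"
  shows "stiefel_form Y (colrot v) = (Y \<bullet> v) / 2"
    "stiefel_form Y Y = 0" "stiefel_form Y (colneg Y) = 0" "stiefel_form Y (colswap Y) = 0"
    "stiefel_form Y (colrot Y) = 1"
  using stiefel2_inner[OF Y] by (simp_all add: stiefel_form_def colop_adjoint(1)[of Y])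

locale stiefel_plane =
  fixes Y P Q x y :: "real^2^'n::finite" and A B \<alpha> :: real
  assumes \<alpha>: "\<alpha> > 0" and Y: "Y \<in> stiefel2"
    and P: "Y \<bullet> P = 0" "Y \<bullet> colrot P = 0" "Y \<bullet> colneg P = 0" "Y \<bullet> colswap P = 0"
    and Q: "Y \<bullet> Q = 0" "Y \<bullet> colrot Q = 0" "Y \<bullet> colneg Q = 0" "Y \<bullet> colswap Q = 0"
    and x_eq: "x = A *\<^sub>R colrot Y + P" and y_eq: "y = B *\<^sub>R colrot Y + Q"
begin

lemma PQ_swap: "Q \<bullet> P = P \<bullet> Q" "Q \<bullet> colrot P = - (P \<bullet> colrot Q)"
  "Q \<bullet> colneg P = P \<bullet> colneg Q" "Q \<bullet> colswap P = P \<bullet> colswap Q"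
  using colop_adjoint[of P Q] by (simp_all add: inner_commute)

lemma hor_swap:
  "P \<bullet> Y = 0" "P \<bullet> colrot Y = 0" "P \<bullet> colneg Y = 0" "P \<bullet> colswap Y = 0"
  "Q \<bullet> Y = 0" "Q \<bullet> colrot Y = 0" "Q \<bullet> colneg Y = 0" "Q \<bullet> colswap Y = 0"
  using P Q colop_adjoint[of Y P] colop_adjoint[of Y Q] by (simp_all add: inner_commute)

lemma YY: "Y \<bullet> Y = 2" "Y \<bullet> colneg Y = 0" "Y \<bullet> colswap Y = 0"
  using stiefel2_inner[OF Y] by simp_all

lemmas expand = inner_add_left inner_add_right inner_diff_left inner_diff_right
  colop_adjoint P Q PQ_swap hor_swap YY

lemma tangent: "x \<in> tangent_space stiefel2 Y" "y \<in> tangent_space stiefel2 Y"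
  unfolding tangent_space_stiefel2[OF Y] x_eq y_eq by (simp_all add: expand)

lemma form: "stiefel_form Y x = A" "stiefel_form Y y = B"
  unfolding stiefel_form_def x_eq y_eq by (simp_all add: expand)

lemma metric:
  "stiefel_metric \<alpha> Y x x = P \<bullet> P + 2 * \<alpha> * A\<^sup>2"
  "stiefel_metric \<alpha> Y y y = Q \<bullet> Q + 2 * \<alpha> * B\<^sup>2"
  "stiefel_metric \<alpha> Y x y = P \<bullet> Q + 2 * \<alpha> * A * B"
  unfolding stiefel_metric_tangent[OF Y tangent(1)] stiefel_metric_tangent[OF Y tangent(2)] form
  unfolding x_eq y_eq by (simp_all add: expand power2_eq_square algebra_simps)

lemma form_expand: "stiefel_form v w = - (v \<bullet> colrot w) / 2"
  by (simp add: stiefel_form_def colop_adjoint)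

text \<open>The four summands of \<open>curv\<close> are evaluated separately, with all inner
  products reduced to those of \<open>P\<close> and \<open>Q\<close>. The terms in \<open>A\<close>
  and \<open>B\<close> then combine into the last square, and the fraction is what is later called
  \<open>row_area\<close>.\<close>

lemma numerator:
  "stiefel_metric \<alpha> Y (christoffel.curv (stiefel_christoffel \<alpha>) (stiefel_christoffel_deriv \<alpha>) Y x y y) x =
   ((P \<bullet> P) * (Q \<bullet> Q) - (P \<bullet> Q)\<^sup>2 + ((P \<bullet> colneg P) * (Q \<bullet> colneg Q) - (P \<bullet> colneg Q)\<^sup>2)
     + ((P \<bullet> colswap P) * (Q \<bullet> colswap Q) - (P \<bullet> colswap Q)\<^sup>2) + (P \<bullet> colrot Q)\<^sup>2) / 2
   + (1 - 3 * \<alpha> / 2) * (P \<bullet> colrot Q)\<^sup>2 + \<alpha>\<^sup>2 * ((B *\<^sub>R P - A *\<^sub>R Q) \<bullet> (B *\<^sub>R P - A *\<^sub>R Q))"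
proof -
  let ?g = "stiefel_metric \<alpha> Y" and ?c = "stiefel_christoffel \<alpha> Y"
    and ?d = "stiefel_christoffel_deriv \<alpha> Y"
  have curv: "christoffel.curv (stiefel_christoffel \<alpha>) (stiefel_christoffel_deriv \<alpha>) Y x y y =
    ?d x y y - ?d y x y + ?c x (?c y y) - ?c y (?c x y)"
    by (rule christoffel.curv_def[OF christoffel_stiefel2[OF \<alpha>]])
  have g: "?g v x = v \<bullet> x + 2 * (\<alpha> - 1) * stiefel_form Y v * A" for v
    using stiefel_metric_tangent[OF Y tangent(1)] form by simp
  have inn: "x \<bullet> y = 2 * A * B + P \<bullet> Q" "y \<bullet> y = 2 * B\<^sup>2 + Q \<bullet> Q" "x \<bullet> x = 2 * A\<^sup>2 + P \<bullet> P"
    "y \<bullet> x = 2 * A * B + P \<bullet> Q"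
    "x \<bullet> colneg y = P \<bullet> colneg Q" "y \<bullet> colneg y = Q \<bullet> colneg Q" "x \<bullet> colneg x = P \<bullet> colneg P"
    "y \<bullet> colneg x = P \<bullet> colneg Q"
    "x \<bullet> colswap y = P \<bullet> colswap Q" "y \<bullet> colswap y = Q \<bullet> colswap Q" "x \<bullet> colswap x = P \<bullet> colswap P"
    "y \<bullet> colswap x = P \<bullet> colswap Q"
    "x \<bullet> colrot y = P \<bullet> colrot Q" "y \<bullet> colrot x = - (P \<bullet> colrot Q)"
    "Y \<bullet> x = 0" "Y \<bullet> y = 0" "Y \<bullet> colneg x = 0" "Y \<bullet> colneg y = 0" "Y \<bullet> colswap x = 0"
    "Y \<bullet> colswap y = 0" "Y \<bullet> colrot x = - 2 * A" "Y \<bullet> colrot y = - 2 * B"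
    "x \<bullet> Y = 0" "y \<bullet> Y = 0" "x \<bullet> colrot Y = 2 * A" "y \<bullet> colrot Y = 2 * B"
    "x \<bullet> colneg Y = 0" "y \<bullet> colneg Y = 0" "x \<bullet> colswap Y = 0" "y \<bullet> colswap Y = 0"
    by (simp_all add: x_eq y_eq expand power2_eq_square)
  note dist = inner_add_left inner_add_right inner_diff_left inner_diff_right inner_scaleR_left
    inner_scaleR_right colop_linear
  note inn = inn dist colop_adjoint YY
  have d1: "?g (?d x y y) x = (2 * B\<^sup>2 + Q \<bullet> Q) * (2 * A\<^sup>2 + P \<bullet> P) / 2
      + (P \<bullet> colneg P) * (Q \<bullet> colneg Q) / 2 + (P \<bullet> colswap P) * (Q \<bullet> colswap Q) / 2
      + (\<alpha> - 1) * (2 * B\<^sup>2 * (2 * A\<^sup>2 + P \<bullet> P) - (P \<bullet> colrot Q)\<^sup>2)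
      + 2 * (\<alpha> - 1) * A * (A * (2 * B\<^sup>2 + Q \<bullet> Q) / 2 + 2 * (\<alpha> - 1) * B\<^sup>2 * A)"
    unfolding g stiefel_christoffel_deriv_def form stiefel_form_linear form_expand dist
    by (simp add: inn) (simp add: field_simps power2_eq_square)
  have d2: "?g (?d y x y) x = (2 * A * B + P \<bullet> Q)\<^sup>2 / 2 + (P \<bullet> colneg Q)\<^sup>2 / 2 + (P \<bullet> colswap Q)\<^sup>2 / 2
      + (\<alpha> - 1) * ((P \<bullet> colrot Q)\<^sup>2 / 2 + 2 * A * B * (2 * A * B + P \<bullet> Q))
      + 2 * (\<alpha> - 1) * A * ((2 * A * B + P \<bullet> Q) * B / 2 + 2 * (\<alpha> - 1) * A * B\<^sup>2)"
    unfolding g stiefel_christoffel_deriv_def form stiefel_form_linear form_expand dist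
    by (simp add: inn) (simp add: field_simps power2_eq_square)
  \<comment> \<open>The second argument is arbitrary because the inner Christoffel value is not
    tangent: the term with \<open>Y \<bullet> z\<close> accounts for its normal component, which the
    next fact computes.\<close>
  have c: "?g (?c u z) x = (\<alpha> - 1) * (stiefel_form Y z * (colrot u \<bullet> x) + stiefel_form Y u * (colrot z \<bullet> x))
      + (\<alpha> - 1)\<^sup>2 * stiefel_form Y u * (Y \<bullet> z) * A" if "u \<in> {x, y}" for u z
    using that unfolding g stiefel_christoffel_def stiefel_form_linear
    by (auto simp: inn stiefel_form_colop[OF Y]) (simp add: field_simps power2_eq_square)+
  have z: "stiefel_form Y (?c u v) = 0" "Y \<bullet> ?c u v = u \<bullet> v"
    "colrot (?c u v) \<bullet> x = A * (u \<bullet> v) + (\<alpha> - 1) * (4 * stiefel_form Y u * stiefel_form Y v * A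
       - stiefel_form Y v * (u \<bullet> x) - stiefel_form Y u * (v \<bullet> x))"
    if "u \<in> {x, y}" "v \<in> {x, y}" for u v
  proof -
    show "stiefel_form Y (?c u v) = 0"
      using that unfolding stiefel_christoffel_def
      by (auto simp: stiefel_form_colop[OF Y] inn)
    show "Y \<bullet> ?c u v = u \<bullet> v"
      using that unfolding stiefel_christoffel_def dist by (auto simp: inn form)
    show "colrot (?c u v) \<bullet> x = A * (u \<bullet> v) + (\<alpha> - 1) * (4 * stiefel_form Y u * stiefel_form Y v * A
       - stiefel_form Y v * (u \<bullet> x) - stiefel_form Y u * (v \<bullet> x))"
      using that unfolding stiefel_christoffel_def dist
      by (elim insertE emptyE; simp add: inn form; simp add: field_simps power2_eq_square)
  qed
  have c1: "?g (?c x (?c y y)) x = (\<alpha> - 1) * A * (A * (2 * B\<^sup>2 + Q \<bullet> Q) - 2 * (\<alpha> - 1) * B * (P \<bullet> Q))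
      + (\<alpha> - 1)\<^sup>2 * A\<^sup>2 * (2 * B\<^sup>2 + Q \<bullet> Q)"
    by (simp add: c z form) (simp add: inn power2_eq_square algebra_simps)
  have c2: "?g (?c y (?c x y)) x = (\<alpha> - 1) * B * (A * (2 * A * B + P \<bullet> Q) - (\<alpha> - 1) * (B * (P \<bullet> P) + A * (P \<bullet> Q)))
      + (\<alpha> - 1)\<^sup>2 * A * B * (2 * A * B + P \<bullet> Q)"
    by (simp add: c z form) (simp add: inn power2_eq_square algebra_simps)
  show ?thesis
    unfolding curv bilinear_lsub[OF bilinear_stiefel_metric] bilinear_ladd[OF bilinear_stiefel_metric]
      d1 d2 c1 c2
    by (simp add: expand power2_eq_square field_simps)
qed

end

section \<open>Inequalities between the areas\<close>

lemma bessel_pair: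
  fixes a b q :: "'a::real_inner"
  assumes "a \<bullet> b = 0" "a = 0 \<or> a \<bullet> a = 1" "b = 0 \<or> b \<bullet> b = 1"
  shows "(q \<bullet> a)\<^sup>2 + (q \<bullet> b)\<^sup>2 \<le> q \<bullet> q"
proof -
  have "0 \<le> (q - (q \<bullet> a) *\<^sub>R a - (q \<bullet> b) *\<^sub>R b) \<bullet> (q - (q \<bullet> a) *\<^sub>R a - (q \<bullet> b) *\<^sub>R b)"
    by (rule inner_ge_zero)
  also have "\<dots> = q \<bullet> q - (q \<bullet> a)\<^sup>2 - (q \<bullet> b)\<^sup>2"
    using assms by (auto simp: inner_diff_left inner_diff_right inner_commute power2_eq_square)
  finally show ?thesis by simp
qed

text \<open>The right-hand side is the squared norm of the bivector \<open>p1 \<and> q1 + p2 \<and> q2\<close>.\<close>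

lemma wedge_sum_nonneg:
  fixes p1 p2 q1 q2 :: "real^'n::finite"
  shows "0 \<le> (p1 \<bullet> p1) * (q1 \<bullet> q1) - (p1 \<bullet> q1)\<^sup>2 + (p2 \<bullet> p2) * (q2 \<bullet> q2) - (p2 \<bullet> q2)\<^sup>2
     + 2 * ((p1 \<bullet> p2) * (q1 \<bullet> q2) - (p1 \<bullet> q2) * (q1 \<bullet> p2))" (is "0 \<le> ?r")
proof -
  have prod: "(\<Sum>i\<in>UNIV. \<Sum>j\<in>UNIV. (a $ i * b $ j) * (c $ i * d $ j)) = (a \<bullet> c) * (b \<bullet> d)"
    for a b c d :: "real^'n"
    by (simp add: inner_vec_def sum_product mult_ac)
  let ?t = "\<lambda>a b c d i j. (a $ i * b $ j) * (c $ i * d $ j) :: real"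
  have "0 \<le> (\<Sum>i\<in>UNIV. \<Sum>j\<in>UNIV. (p1 $ i * q1 $ j - q1 $ i * p1 $ j + (p2 $ i * q2 $ j - q2 $ i * p2 $ j))\<^sup>2)"
    by (intro sum_nonneg) simp
  also have "\<dots> = (\<Sum>i\<in>UNIV. \<Sum>j\<in>UNIV.
      ?t p1 q1 p1 q1 i j - 2 * ?t p1 q1 q1 p1 i j + ?t q1 p1 q1 p1 i j +
      ?t p2 q2 p2 q2 i j - 2 * ?t p2 q2 q2 p2 i j + ?t q2 p2 q2 p2 i j +
      2 * ?t p1 q1 p2 q2 i j - 2 * ?t p1 q1 q2 p2 i j - 2 * ?t q1 p1 p2 q2 i j + 2 * ?t q1 p1 q2 p2 i j)"
    by (intro sum.cong refl) (simp add: power2_eq_square algebra_simps)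
  \<comment> \<open>Entries \<open>(i, j)\<close> and \<open>(j, i)\<close> of the bivector have
    equal squares, hence the factor 2.\<close>
  also have "\<dots> = 2 * ?r"
    by (simp add: sum.distrib sum_subtractf prod flip: sum_distrib_left)
       (simp add: power2_eq_square inner_commute algebra_simps)
  finally show ?thesis by simp
qed

text \<open>
  Orthonormalize \<open>p1, p2\<close> to \<open>a, b\<close> (with a zero vector in degenerate cases, since \<open>sgn 0 = 0\<close>). After
  Bessel's inequality with respect to \<open>a, b\<close>, what remains is a sum of two squares.
\<close>

lemma wedge_sum_le:
  fixes p1 p2 q1 q2 :: "'a::real_inner"
  shows "0 \<le> (p1 \<bullet> p1) * (q2 \<bullet> q2) + (q1 \<bullet> q1) * (p2 \<bullet> p2) - 2 * (p1 \<bullet> q1) * (p2 \<bullet> q2)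
     - 2 * (p1 \<bullet> p2) * (q1 \<bullet> q2) + 2 * (p1 \<bullet> q2) * (q1 \<bullet> p2)"
proof -
  define a s where "a = sgn p1" and "s = norm p1"
  define u r where "u = p2 \<bullet> a" and "r = p2 - u *\<^sub>R a"
  define b t where "b = sgn r" and "t = norm r"
  have sg: "v = norm v *\<^sub>R sgn v" "sgn v = 0 \<or> sgn v \<bullet> sgn v = 1" for v :: 'a
    by (cases "v = 0"; simp add: sgn_div_norm dot_square_norm power2_eq_square)+
  have a: "a = 0 \<or> a \<bullet> a = 1" and b: "b = 0 \<or> b \<bullet> b = 1" and p1: "p1 = s *\<^sub>R a" and "r = t *\<^sub>R b"
    unfolding a_def b_def s_def t_def by (fact sg)+
  then have p2: "p2 = u *\<^sub>R a + t *\<^sub>R b" by (simp add: r_def algebra_simps)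
  have "a \<bullet> r = 0" using a by (auto simp: r_def u_def inner_diff_right inner_commute)
  then have ab: "a \<bullet> b = 0" by (simp add: b_def sgn_div_norm)
  \<comment> \<open>When a direction degenerates to zero its coefficient is zero as well, so the
    formulas for orthonormal \<open>a\<close>, \<open>b\<close> persist.\<close>
  have z: "s = 0 \<or> a \<bullet> a = 1" "t = 0 \<or> b \<bullet> b = 1" "u = 0 \<or> a \<bullet> a = 1"
    using a b by (auto simp: a_def s_def b_def t_def u_def sgn_zero_iff)
  have n: "p1 \<bullet> p1 = s\<^sup>2" "p2 \<bullet> p2 = u\<^sup>2 + t\<^sup>2" "p1 \<bullet> p2 = s * u"
    using z ab by (auto simp: p1 p2 inner_add_left inner_add_right inner_commute[of b a] power2_eq_square)
  define x1 y1 x2 y2 where "x1 = q1 \<bullet> a" and "y1 = q1 \<bullet> b" and "x2 = q2 \<bullet> a" and "y2 = q2 \<bullet> b"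
  have m: "p1 \<bullet> q1 = s * x1" "p1 \<bullet> q2 = s * x2" "q1 \<bullet> p2 = u * x1 + t * y1" "p2 \<bullet> q2 = u * x2 + t * y2"
    by (simp_all add: p1 p2 x1_def x2_def y1_def y2_def inner_add_left inner_add_right inner_commute)
  have "(s * x2 - u * x1)\<^sup>2 + (s * y2 - u * y1)\<^sup>2 \<le> (s *\<^sub>R q2 - u *\<^sub>R q1) \<bullet> (s *\<^sub>R q2 - u *\<^sub>R q1)"
    using bessel_pair[OF ab a b, of "s *\<^sub>R q2 - u *\<^sub>R q1"]
    by (simp add: x1_def x2_def y1_def y2_def inner_diff_left)
  moreover have "t\<^sup>2 * (x1\<^sup>2 + y1\<^sup>2) \<le> t\<^sup>2 * (q1 \<bullet> q1)"
    using bessel_pair[OF ab a b, of q1] by (auto intro!: mult_left_mono simp: x1_def y1_def)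
  moreover have "s\<^sup>2 * (q2 \<bullet> q2) + (q1 \<bullet> q1) * (u\<^sup>2 + t\<^sup>2) - 2 * (s * x1) * (u * x2 + t * y2)
      - 2 * (s * u) * (q1 \<bullet> q2) + 2 * (s * x2) * (u * x1 + t * y1) =
      (s *\<^sub>R q2 - u *\<^sub>R q1) \<bullet> (s *\<^sub>R q2 - u *\<^sub>R q1) + t\<^sup>2 * (q1 \<bullet> q1)
      - 2 * s * t * x1 * y2 + 2 * s * t * x2 * y1"
    by (simp add: inner_diff_left inner_diff_right inner_commute[of q2 q1] power2_eq_square algebra_simps)
  moreover have "(s * x2 - u * x1)\<^sup>2 + (s * y2 - u * y1)\<^sup>2 + t\<^sup>2 * (x1\<^sup>2 + y1\<^sup>2)
      - 2 * s * t * x1 * y2 + 2 * s * t * x2 * y1 =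
      (s * y2 - u * y1 - t * x1)\<^sup>2 + (s * x2 - u * x1 + t * y1)\<^sup>2"
    by (simp add: power2_eq_square algebra_simps)
  moreover have "0 \<le> (s * y2 - u * y1 - t * x1)\<^sup>2 + (s * x2 - u * x1 + t * y1)\<^sup>2"
    by simp
  ultimately show ?thesis
    unfolding n m by linarith
qed

definition plane_area :: "'a::real_inner \<Rightarrow> 'a \<Rightarrow> real" where
  "plane_area P Q = (P \<bullet> P) * (Q \<bullet> Q) - (P \<bullet> Q)\<^sup>2"

text \<open>
  The squared norm of \<open>p1 \<and> q1 + p2 \<and> q2\<close> for the columns of \<open>P\<close> and \<open>Q\<close>, equivalently half the squared
  norm of \<open>P ** transpose Q - Q ** transpose P\<close>, in the form in which it appears in the curvature.
\<close>

definition row_area :: "real^2^'n::finite \<Rightarrow> real^2^'n \<Rightarrow> real" where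
  "row_area P Q = (plane_area P Q + ((P \<bullet> colneg P) * (Q \<bullet> colneg Q) - (P \<bullet> colneg Q)\<^sup>2)
     + ((P \<bullet> colswap P) * (Q \<bullet> colswap Q) - (P \<bullet> colswap Q)\<^sup>2) + (P \<bullet> colrot Q)\<^sup>2) / 2"

lemma plane_area_nonneg: "0 \<le> plane_area P Q"
  using Cauchy_Schwarz_ineq[of P Q] by (simp add: plane_area_def)

lemma row_area_nonneg: "0 \<le> row_area P Q"
  using wedge_sum_nonneg[of "column 1 P" "column 1 Q" "column 2 P" "column 2 Q"]
  by (simp add: row_area_def plane_area_def inner_columns colop_defs power2_eq_square inner_commute
      field_simps)

text \<open>The expression bounded in \<open>wedge_sum_le\<close> is precisely the difference of the
  two sides.\<close>

lemma row_area_le: "row_area P Q \<le> plane_area P Q"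
  using wedge_sum_le[of "column 1 P" "column 2 Q" "column 1 Q" "column 2 P"]
  by (simp add: row_area_def plane_area_def inner_columns colop_defs power2_eq_square inner_commute
      field_simps)

text \<open>\<open>colrot Q\<close> is orthogonal to \<open>Q\<close> and equally long.
  \<open>?v\<close> is \<open>Q \<bullet> Q\<close> times the component of \<open>P\<close>
  orthogonal to both, and its squared length is \<open>Q \<bullet> Q\<close> times the difference of
  the two sides.\<close>

lemma inner_colrot_le: "(P \<bullet> colrot Q)\<^sup>2 \<le> plane_area P Q"
proof -
  let ?v = "(Q \<bullet> Q) *\<^sub>R P - (P \<bullet> Q) *\<^sub>R Q - (P \<bullet> colrot Q) *\<^sub>R colrot Q"
  have "colrot Q \<bullet> P = P \<bullet> colrot Q" "Q \<bullet> colrot P = - (P \<bullet> colrot Q)"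
    using colop_adjoint(1)[of P Q] by (simp_all add: inner_commute)
  then have "?v \<bullet> ?v = (Q \<bullet> Q) * (plane_area P Q - (P \<bullet> colrot Q)\<^sup>2)"
    by (simp add: plane_area_def inner_diff_left inner_diff_right colop_adjoint(1)[of Q]
        inner_commute[of Q P] power2_eq_square algebra_simps)
  then have "0 \<le> (Q \<bullet> Q) * (plane_area P Q - (P \<bullet> colrot Q)\<^sup>2)"
    by (metis inner_ge_zero)
  moreover have "P \<bullet> colrot Q = 0" if "Q = 0"
    using colop_linear(4)[of 0 Q] that by simp
  moreover have "Q \<bullet> Q \<le> 0 \<longleftrightarrow> Q = 0" using inner_gt_zero_iff[of Q] by linarith
  ultimately show ?thesis
    using plane_area_nonneg[of P Q] by (cases "Q = 0") (auto simp: zero_le_mult_iff)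
qed

section \<open>Sections as pairs of horizontal matrices\<close>

definition horizontal :: "real^2^'n::finite \<Rightarrow> real^2^'n \<Rightarrow> bool" where
  "horizontal Y P \<longleftrightarrow> Y \<bullet> P = 0 \<and> Y \<bullet> colrot P = 0 \<and> Y \<bullet> colneg P = 0 \<and> Y \<bullet> colswap P = 0"

definition curvature_num :: "real \<Rightarrow> real^2^'n::finite \<Rightarrow> real^2^'n \<Rightarrow> real \<Rightarrow> real \<Rightarrow> real" where
  "curvature_num \<alpha> P Q A B = row_area P Q + (1 - 3 * \<alpha> / 2) * (P \<bullet> colrot Q)\<^sup>2
     + \<alpha>\<^sup>2 * ((B *\<^sub>R P - A *\<^sub>R Q) \<bullet> (B *\<^sub>R P - A *\<^sub>R Q))"

definition curvature_den :: "real \<Rightarrow> real^2^'n::finite \<Rightarrow> real^2^'n \<Rightarrow> real \<Rightarrow> real \<Rightarrow> real" where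
  "curvature_den \<alpha> P Q A B = plane_area P Q + 2 * \<alpha> * ((B *\<^sub>R P - A *\<^sub>R Q) \<bullet> (B *\<^sub>R P - A *\<^sub>R Q))"

lemma horizontal_iff_columns:
  "horizontal Y P \<longleftrightarrow> (\<forall>i\<in>{1,2}. \<forall>j\<in>{1,2}. column i Y \<bullet> column j P = 0)"
  by (auto simp: horizontal_def inner_columns colop_defs)

lemma tangent_decomposition:
  assumes Y: "Y \<in> stiefel2" and x: "x \<in> tangent_space stiefel2 Y"
  obtains A P where "horizontal Y P" "x = A *\<^sub>R colrot Y + P"
proof
  show "x = stiefel_form Y x *\<^sub>R colrot Y + (x - stiefel_form Y x *\<^sub>R colrot Y)" by simp
  show "horizontal Y (x - stiefel_form Y x *\<^sub>R colrot Y)"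
    using x stiefel2_inner[OF Y] unfolding tangent_space_stiefel2[OF Y]
    by (simp add: horizontal_def stiefel_form_def inner_diff_right inner_add_right colop_adjoint)
qed

text \<open>Under a change of basis, Gram determinants of symmetric forms and squares of skew forms
  scale by the squared determinant, and \<open>B *\<^sub>R P - A *\<^sub>R Q\<close> scales by the
  determinant. Hence the quotient depends on the section only.\<close>

lemma curvature_num_scale:
  fixes P Q :: "real^2^'n::finite"
  shows "curvature_num \<alpha> (a *\<^sub>R P + b *\<^sub>R Q) (c *\<^sub>R P + d *\<^sub>R Q) (a * A + b * B) (c * A + d * B)
    = (a * d - b * c)\<^sup>2 * curvature_num \<alpha> P Q A B"
  "curvature_den \<alpha> (a *\<^sub>R P + b *\<^sub>R Q) (c *\<^sub>R P + d *\<^sub>R Q) (a * A + b * B) (c * A + d * B)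
    = (a * d - b * c)\<^sup>2 * curvature_den \<alpha> P Q A B"
proof -
  let ?P = "a *\<^sub>R P + b *\<^sub>R Q" and ?Q = "c *\<^sub>R P + d *\<^sub>R Q" and ?D = "(a * d - b * c)\<^sup>2"
  have swap: "Q \<bullet> P = P \<bullet> Q" "Q \<bullet> colrot P = - (P \<bullet> colrot Q)"
    "Q \<bullet> colneg P = P \<bullet> colneg Q" "Q \<bullet> colswap P = P \<bullet> colswap Q"
    using colop_adjoint[of P Q] by (simp_all add: inner_commute)
  note simps = inner_add_left inner_add_right swap power2_eq_square
  have gen: "(a * a * p + 2 * a * b * m + b * b * q) * (c * c * p + 2 * c * d * m + d * d * q)
      - (a * c * p + (a * d + b * c) * m + b * d * q)\<^sup>2 = ?D * (p * q - m\<^sup>2)" for p q m :: real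
    by (simp add: power2_eq_square algebra_simps)
  have sq: "(?P \<bullet> L ?P) * (?Q \<bullet> L ?Q) - (?P \<bullet> L ?Q)\<^sup>2 = ?D * ((P \<bullet> L P) * (Q \<bullet> L Q) - (P \<bullet> L Q)\<^sup>2)"
    if "Q \<bullet> L P = P \<bullet> L Q" "\<And>u v. L (u + v) = L u + L v" "\<And>r v. L (r *\<^sub>R v) = r *\<^sub>R L v"
    for L :: "real^2^'n \<Rightarrow> real^2^'n"
    using gen[of "P \<bullet> L P" "P \<bullet> L Q" "Q \<bullet> L Q"]
    by (simp add: that inner_add_left inner_add_right algebra_simps)
  have rot: "(?P \<bullet> colrot ?Q) = (a * d - b * c) * (P \<bullet> colrot Q)"
    by (simp add: simps algebra_simps)
  have area: "plane_area ?P ?Q = ?D * plane_area P Q"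
    unfolding plane_area_def using sq[of "\<lambda>v. v"] swap by simp
  have row: "row_area ?P ?Q = ?D * row_area P Q"
    unfolding row_area_def area rot sq[of colneg, OF swap(3) colop_linear(5,8)]
      sq[of colswap, OF swap(4) colop_linear(9,12)] power_mult_distrib
    by (simp add: field_simps)
  have "(c * A + d * B) *\<^sub>R ?P - (a * A + b * B) *\<^sub>R ?Q = (a * d - b * c) *\<^sub>R (B *\<^sub>R P - A *\<^sub>R Q)"
    by (simp add: algebra_simps)
  then have t: "((c * A + d * B) *\<^sub>R ?P - (a * A + b * B) *\<^sub>R ?Q) \<bullet> ((c * A + d * B) *\<^sub>R ?P - (a * A + b * B) *\<^sub>R ?Q)
      = ?D * ((B *\<^sub>R P - A *\<^sub>R Q) \<bullet> (B *\<^sub>R P - A *\<^sub>R Q))"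
    by (simp add: power2_eq_square)
  show "curvature_num \<alpha> ?P ?Q (a * A + b * B) (c * A + d * B) = ?D * curvature_num \<alpha> P Q A B"
    "curvature_den \<alpha> ?P ?Q (a * A + b * B) (c * A + d * B) = ?D * curvature_den \<alpha> P Q A B"
    unfolding curvature_num_def curvature_den_def area row rot t power_mult_distrib
    by (simp_all add: algebra_simps)
qed

lemma stiefel_plane_curvature:
  assumes "\<alpha> > 0" "Y \<in> stiefel2" "horizontal Y P" "horizontal Y Q"
    and "x = A *\<^sub>R colrot Y + P" "y = B *\<^sub>R colrot Y + Q"
  shows "stiefel_metric \<alpha> Y (christoffel.curv (stiefel_christoffel \<alpha>) (stiefel_christoffel_deriv \<alpha>) Y x y y) x
      = curvature_num \<alpha> P Q A B"
    and "stiefel_metric \<alpha> Y x x * stiefel_metric \<alpha> Y y y - (stiefel_metric \<alpha> Y x y)\<^sup>2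
      = curvature_den \<alpha> P Q A B"
    and "x \<in> tangent_space stiefel2 Y" "y \<in> tangent_space stiefel2 Y"
proof -
  interpret stiefel_plane Y P Q x y A B \<alpha>
    using assms by unfold_locales (auto simp: horizontal_def)
  show "stiefel_metric \<alpha> Y (christoffel.curv (stiefel_christoffel \<alpha>) (stiefel_christoffel_deriv \<alpha>) Y x y y) x
      = curvature_num \<alpha> P Q A B"
    unfolding numerator curvature_num_def row_area_def plane_area_def ..
  show "stiefel_metric \<alpha> Y x x * stiefel_metric \<alpha> Y y y - (stiefel_metric \<alpha> Y x y)\<^sup>2
      = curvature_den \<alpha> P Q A B"
    unfolding metric curvature_den_def plane_area_def
    by (simp add: inner_diff_left inner_diff_right inner_commute[of Q P] power2_eq_square algebra_simps)
  show "x \<in> tangent_space stiefel2 Y" "y \<in> tangent_space stiefel2 Y" by (fact tangent)+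
qed

lemma sectional_curvature_stiefel2:
  assumes \<alpha>: "\<alpha> > 0" and Y: "Y \<in> stiefel2" and P: "horizontal Y P" and Q: "horizontal Y Q"
    and x: "x = A *\<^sub>R colrot Y + P" and y: "y = B *\<^sub>R colrot Y + Q"
    and \<sigma>: "span {x, y} \<in> tangent_sections stiefel2 Y" and den: "curvature_den \<alpha> P Q A B \<noteq> 0"
  shows "sectional_curvature stiefel2 (stiefel_metric \<alpha>) Y (span {x, y}) =
    curvature_num \<alpha> P Q A B / curvature_den \<alpha> P Q A B"
proof (rule christoffel.sectional_curvature_eqI[OF christoffel_stiefel2[OF \<alpha>] Y \<sigma>])
  fix x' y' assume sp: "span {x', y'} = span {x, y}"
  have "x' \<in> span {x, y}" "y' \<in> span {x, y}" "x \<in> span {x', y'}" "y \<in> span {x', y'}"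
    using sp by (auto intro: span_base)
  then have "x' \<in> tangent_space stiefel2 Y" "y' \<in> tangent_space stiefel2 Y"
    using \<sigma> unfolding tangent_sections_def by auto
  then obtain A' P' B' Q' where P': "horizontal Y P'" "x' = A' *\<^sub>R colrot Y + P'"
    and Q': "horizontal Y Q'" "y' = B' *\<^sub>R colrot Y + Q'"
    using tangent_decomposition[OF Y] by metis
  \<comment> \<open>The given pair is expressed in the arbitrary one, not conversely: then
    \<open>den\<close> forces \<open>a * d - b * c\<close> to be nonzero and the common factor
    cancels.\<close>
  obtain a b c d where xy: "x = a *\<^sub>R x' + b *\<^sub>R y'" "y = c *\<^sub>R x' + d *\<^sub>R y'"
    using \<open>x \<in> span {x', y'}\<close> \<open>y \<in> span {x', y'}\<close>
    unfolding span_insert span_empty by (auto simp: algebra_simps)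
  have comp: "A1 = A2 \<and> P1 = P2"
    if "A1 *\<^sub>R colrot Y + P1 = A2 *\<^sub>R colrot Y + P2" "horizontal Y P1" "horizontal Y P2"
    for A1 A2 P1 P2
  proof -
    have "colrot Y \<bullet> (A1 *\<^sub>R colrot Y + P1) = colrot Y \<bullet> (A2 *\<^sub>R colrot Y + P2)"
      using that(1) by simp
    moreover have "colrot Y \<bullet> P1 = 0" "colrot Y \<bullet> P2 = 0"
      using that(2,3) colop_adjoint(1)[of Y] by (simp_all add: horizontal_def)
    ultimately have "A1 = A2"
      by (simp add: inner_add_right stiefel2_inner[OF Y])
    then show ?thesis using that(1) by simp
  qed
  have hor: "horizontal Y (r *\<^sub>R P' + s *\<^sub>R Q')" for r s
    using P'(1) Q'(1) by (simp add: horizontal_def inner_add_right)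
  have "A = a * A' + b * B' \<and> P = a *\<^sub>R P' + b *\<^sub>R Q'"
    by (rule comp) (use xy(1) x P' Q' P hor in \<open>simp_all add: algebra_simps\<close>)
  moreover have "B = c * A' + d * B' \<and> Q = c *\<^sub>R P' + d *\<^sub>R Q'"
    by (rule comp) (use xy(2) y P' Q' Q hor in \<open>simp_all add: algebra_simps\<close>)
  ultimately have "curvature_num \<alpha> P Q A B = (a * d - b * c)\<^sup>2 * curvature_num \<alpha> P' Q' A' B'"
    "curvature_den \<alpha> P Q A B = (a * d - b * c)\<^sup>2 * curvature_den \<alpha> P' Q' A' B'"
    using curvature_num_scale by simp_all
  then show "stiefel_metric \<alpha> Y (christoffel.curv (stiefel_christoffel \<alpha>) (stiefel_christoffel_deriv \<alpha>)
        Y x' y' y') x' / (stiefel_metric \<alpha> Y x' x' * stiefel_metric \<alpha> Y y' y' - (stiefel_metric \<alpha> Y x' y')\<^sup>2) =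
      curvature_num \<alpha> P Q A B / curvature_den \<alpha> P Q A B"
    unfolding stiefel_plane_curvature[OF \<alpha> Y P'(1) Q'(1) P'(2) Q'(2)] using den by simp
qed

lemma curvature_den_nonneg:
  assumes "\<alpha> > 0"
  shows "0 \<le> curvature_den \<alpha> P Q A B"
  unfolding curvature_den_def using assms plane_area_nonneg by (intro add_nonneg_nonneg) auto

text \<open>This is the equality case of Cauchy-Schwarz: for nonzero \<open>y\<close>, the vector
  \<open>?v\<close> has squared length \<open>g y y\<close> times the Gram determinant and vanishes
  exactly when \<open>x\<close> is a multiple of \<open>y\<close>.\<close>

lemma independent_pair_iff_gram:
  fixes x y :: "real^2^'n::finite"
  assumes \<alpha>: "\<alpha> > 0" and Y: "Y \<in> stiefel2"
    and x: "x \<in> tangent_space stiefel2 Y" and y: "y \<in> tangent_space stiefel2 Y"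
  defines "g \<equiv> stiefel_metric \<alpha> Y"
  shows "independent {x, y} \<and> x \<noteq> y \<longleftrightarrow> g x x * g y y - (g x y)\<^sup>2 \<noteq> 0"
proof -
  have bil: "bilinear g" and sym: "g u v = g v u" for u v
    unfolding g_def by (rule bilinear_stiefel_metric stiefel_metric_commute)+
  have sub: "subspace (tangent_space stiefel2 Y)"
    using christoffel.subspace_tangent[OF christoffel_stiefel2[OF \<alpha>] Y] .
  have pos: "g v v > 0" if "v \<in> tangent_space stiefel2 Y" "v \<noteq> 0" for v
    unfolding g_def using stiefel_metric_pos[OF \<alpha> Y that] .
  have zero: "g u 0 = 0" for u using bilinear_rzero[OF bil] .
  show ?thesis
  proof (cases "y = 0")
    case True
    then show ?thesis using zero dependent_zero[of "{x, y}"] by simp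
  next
    case False
    let ?v = "g y y *\<^sub>R x - g x y *\<^sub>R y"
    have gv: "g ?v ?v = g y y * (g x x * g y y - (g x y)\<^sup>2)"
      by (simp add: bilinear_lsub[OF bil] bilinear_rsub[OF bil] bilinear_lmul[OF bil]
          bilinear_rmul[OF bil] sym[of y x] power2_eq_square algebra_simps)
    have "?v \<in> tangent_space stiefel2 Y"
      using x y by (intro subspace_diff[OF sub] subspace_scale[OF sub])
    then have "g x x * g y y - (g x y)\<^sup>2 \<noteq> 0 \<longleftrightarrow> ?v \<noteq> 0"
      using gv pos[of ?v] pos[OF y False] zero by fastforce
    also have "\<dots> \<longleftrightarrow> x \<notin> span {y}"
    proof -
      have "?v = 0" if "x = k *\<^sub>R y" for k
        unfolding that by (simp add: bilinear_lmul[OF bil])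
      moreover have "x = (g x y / g y y) *\<^sub>R y" if "?v = 0"
        using that pos[OF y False] by (simp add: field_simps eq_vector_fraction_iff)
      ultimately show ?thesis by (auto simp: span_singleton)
    qed
    also have "\<dots> \<longleftrightarrow> independent {x, y} \<and> x \<noteq> y"
      using False by (auto simp: independent_insert span_base)
    finally show ?thesis by simp
  qed
qed

text \<open>This leaves only the algebra of horizontal pairs; positivity of
  \<open>curvature_den\<close> encodes that the two vectors span a plane.\<close>

lemma sectional_curvature_range_stiefel2:
  assumes \<alpha>: "\<alpha> > 0"
  shows "k \<in> sectional_curvature_range (stiefel2 :: (real^2^'n::finite) set) (stiefel_metric \<alpha>) \<longleftrightarrow>
    (\<exists>Y P Q :: real^2^'n. \<exists>A B. Y \<in> stiefel2 \<and> horizontal Y P \<and> horizontal Y Q \<and>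
       curvature_den \<alpha> P Q A B > 0 \<and> k = curvature_num \<alpha> P Q A B / curvature_den \<alpha> P Q A B)"
    (is "_ \<longleftrightarrow> ?r")
proof
  assume "k \<in> sectional_curvature_range (stiefel2 :: (real^2^'n) set) (stiefel_metric \<alpha>)"
  then obtain Y :: "real^2^'n" and \<sigma> where Y: "Y \<in> stiefel2" and \<sigma>: "\<sigma> \<in> tangent_sections stiefel2 Y"
    and k: "k = sectional_curvature stiefel2 (stiefel_metric \<alpha>) Y \<sigma>"
    unfolding sectional_curvature_range_def by blast
  obtain S where S: "S \<subseteq> \<sigma>" "independent S" "\<sigma> \<subseteq> span S" "card S = 2"
    using basis_exists[of \<sigma>] \<sigma> unfolding tangent_sections_def by auto
  then obtain x y where xy: "S = {x, y}" "x \<noteq> y"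
    by (auto simp: card_2_iff)
  have sp: "\<sigma> = span {x, y}"
    using S \<sigma> xy span_minimal unfolding tangent_sections_def by blast
  have t: "x \<in> tangent_space stiefel2 Y" "y \<in> tangent_space stiefel2 Y"
    using S(1) \<sigma> xy unfolding tangent_sections_def by auto
  obtain A P B Q where P: "horizontal Y P" "x = A *\<^sub>R colrot Y + P"
    and Q: "horizontal Y Q" "y = B *\<^sub>R colrot Y + Q"
    using tangent_decomposition[OF Y] t by metis
  have "curvature_den \<alpha> P Q A B \<noteq> 0"
    using independent_pair_iff_gram[OF \<alpha> Y t] S(2) xy
      stiefel_plane_curvature(2)[OF \<alpha> Y P(1) Q(1) P(2) Q(2)] by simp
  moreover from this have "k = curvature_num \<alpha> P Q A B / curvature_den \<alpha> P Q A B"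
    using sectional_curvature_stiefel2[OF \<alpha> Y P(1) Q(1) P(2) Q(2)] \<sigma> unfolding k sp by blast
  ultimately show ?r
    using Y P(1) Q(1) curvature_den_nonneg[OF \<alpha>, of P Q A B] by (metis less_eq_real_def)
next
  assume ?r
  then obtain Y P Q :: "real^2^'n" and A B where Y: "Y \<in> stiefel2"
    and P: "horizontal Y P" and Q: "horizontal Y Q" and den: "curvature_den \<alpha> P Q A B > 0"
    and k: "k = curvature_num \<alpha> P Q A B / curvature_den \<alpha> P Q A B" by blast
  define x y where x: "x = A *\<^sub>R colrot Y + P" and y: "y = B *\<^sub>R colrot Y + Q"
  note c = stiefel_plane_curvature[OF \<alpha> Y P Q x y]
  have "independent {x, y}" "x \<noteq> y"
    using independent_pair_iff_gram[OF \<alpha> Y c(3,4)] c(2) den by auto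
  then have "dim (span {x, y}) = 2"
    by (simp add: dim_span dim_eq_card_independent)
  moreover have "span {x, y} \<subseteq> tangent_space stiefel2 Y"
    using c(3,4) christoffel.subspace_tangent[OF christoffel_stiefel2[OF \<alpha>] Y]
    by (intro span_minimal) auto
  ultimately have \<sigma>: "span {x, y} \<in> tangent_sections stiefel2 Y"
    by (simp add: tangent_sections_def)
  then have "k = sectional_curvature stiefel2 (stiefel_metric \<alpha>) Y (span {x, y})"
    unfolding k using sectional_curvature_stiefel2[OF \<alpha> Y P Q x y] den by simp
  then show "k \<in> sectional_curvature_range (stiefel2 :: (real^2^'n) set) (stiefel_metric \<alpha>)"
    using Y \<sigma> unfolding sectional_curvature_range_def by blast
qed

section \<open>The range of the sectional curvature\<close>

lemma areas_card_3:
  fixes Y P Q :: "real^2^'n::finite"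
  assumes card: "CARD('n) = 3" and Y: "Y \<in> stiefel2" and P: "horizontal Y P" and Q: "horizontal Y Q"
  shows "row_area P Q = 0" "(P \<bullet> colrot Q)\<^sup>2 = plane_area P Q"
proof -
  let ?B = "{column 1 Y, column 2 Y}"
  let ?W = "{v :: real^'n. \<forall>w\<in>span ?B. orthogonal w v}"
  have y: "column 1 Y \<bullet> column 1 Y = 1" "column 2 Y \<bullet> column 2 Y = 1" "column 1 Y \<bullet> column 2 Y = 0"
    using Y by (auto simp: stiefel2_iff_columns)
  then have ne: "column 1 Y \<noteq> column 2 Y" "0 \<notin> ?B" by auto
  have "pairwise orthogonal ?B"
    using y by (auto simp: pairwise_def orthogonal_def inner_commute)
  then have "dim ?B = 2"
    using ne pairwise_orthogonal_independent[of ?B] by (simp add: dim_eq_card_independent)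
  moreover have "dim ?W + dim ?B = 3"
    using dim_subspace_orthogonal_to_vectors[of "span ?B" UNIV] card by simp
  ultimately have "dim ?W = 1" by linarith
  obtain B where B: "?W \<subseteq> span B" "card B = dim ?W"
    by (rule basis_exists[of ?W])
  with \<open>dim ?W = 1\<close> obtain e where "B = {e}"
    by (auto simp: card_1_singleton_iff)
  then have e: "?W \<subseteq> span {e}"
    using B(1) by simp
  have line: "\<exists>r. column j R = r *\<^sub>R e" if "horizontal Y R" "j \<in> {1, 2}" for R j
  proof -
    have "orthogonal (column j R) w" if "w \<in> ?B" for w
      using that \<open>horizontal Y R\<close> \<open>j \<in> {1, 2}\<close> horizontal_iff_columns[of Y R]
      by (auto simp: orthogonal_def inner_commute)
    then have "column j R \<in> ?W"
      using orthogonal_to_span[of _ ?B "column j R"] by (auto simp: orthogonal_commute)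
    then show ?thesis using e by (auto simp: span_singleton)
  qed
  obtain p1 where p1: "column 1 P = p1 *\<^sub>R e" using line[OF P, of 1] by auto
  obtain p2 where p2: "column 2 P = p2 *\<^sub>R e" using line[OF P, of 2] by auto
  obtain q1 where q1: "column 1 Q = q1 *\<^sub>R e" using line[OF Q, of 1] by auto
  obtain q2 where q2: "column 2 Q = q2 *\<^sub>R e" using line[OF Q, of 2] by auto
  note c = p1 p2 q1 q2
  \<comment> \<open>Both sides are \<open>(p1 * q2 - p2 * q1)^2\<close> times the fourth power of
    the norm of \<open>e\<close>.\<close>
  show "(P \<bullet> colrot Q)\<^sup>2 = plane_area P Q"
    by (simp add: plane_area_def inner_columns colop_defs c power2_eq_square algebra_simps)
  show "row_area P Q = 0"
    by (simp add: row_area_def plane_area_def inner_columns colop_defs c power2_eq_square algebra_simps)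
qed

section \<open>Families of sections filling the intervals\<close>

context
  fixes a b c :: "'n::finite" and \<alpha> :: real
  assumes \<alpha>: "\<alpha> > 0" and distinct: "a \<noteq> b" "a \<noteq> c" "b \<noteq> c"
begin

text \<open>At \<open>u = 0\<close> the section contains \<open>colrot Y\<close>, at
  \<open>u = 1\<close> it is horizontal. The factor \<open>sqrt (2 * \<alpha> * u)\<close> keeps the
  denominator at \<open>2 * \<alpha>\<close>, so the curvature is affine in
  \<open>u\<close>.\<close>

lemma segment_subset_range_3:
  "closed_segment (\<alpha> / 2) ((2 - 3 * \<alpha>) / 2) \<subseteq>
     sectional_curvature_range (stiefel2 :: (real^2^'n) set) (stiefel_metric \<alpha>)"
proof
  fix k assume "k \<in> closed_segment (\<alpha> / 2) ((2 - 3 * \<alpha>) / 2)"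
  then obtain u where u: "0 \<le> u" "u \<le> 1" "k = (1 - u) * (\<alpha> / 2) + u * ((2 - 3 * \<alpha>) / 2)"
    by (auto simp: closed_segment_def)
  define Y P Q :: "real^2^'n" where "Y = of_columns (axis a 1) (axis b 1)"
    and "P = of_columns (sqrt (2 * \<alpha> * u) *\<^sub>R axis c 1) 0" and "Q = of_columns 0 (axis c 1)"
  define A where "A = sqrt (1 - u)"
  note defs = Y_def P_def Q_def inner_columns colop_defs inner_axis_axis distinct distinct[symmetric]
  have "Y \<in> stiefel2" "horizontal Y P" "horizontal Y Q"
    by (simp_all add: stiefel2_iff_columns horizontal_def defs)
  moreover have *: "plane_area P Q = 2 * \<alpha> * u" "row_area P Q = 0" "(P \<bullet> colrot Q)\<^sup>2 = 2 * \<alpha> * u"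
    "(0 *\<^sub>R P - A *\<^sub>R Q) \<bullet> (0 *\<^sub>R P - A *\<^sub>R Q) = 1 - u"
    using u(1,2) \<alpha> by (simp_all add: plane_area_def row_area_def defs A_def)
  have "curvature_den \<alpha> P Q A 0 = 2 * \<alpha>" "curvature_num \<alpha> P Q A 0 = 2 * \<alpha> * k"
    unfolding curvature_den_def curvature_num_def u(3) * by (simp_all add: power2_eq_square field_simps)
  ultimately show "k \<in> sectional_curvature_range (stiefel2 :: (real^2^'n) set) (stiefel_metric \<alpha>)"
    unfolding sectional_curvature_range_stiefel2[OF \<alpha>] using \<alpha>
    by (intro exI[of _ Y] exI[of _ P] exI[of _ Q] exI[of _ A] exI[of _ 0]) simp
qed

context
  fixes d :: 'n
  assumes distinct_d: "a \<noteq> d" "b \<noteq> d" "c \<noteq> d"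
begin

text \<open>Rotating the second vector between the columns trades \<open>row_area\<close> against
  the squared \<open>colrot\<close> product at constant \<open>plane_area\<close>.\<close>

lemma segment_subset_range_1:
  "closed_segment ((2 - 3 * \<alpha>) / 2) 1 \<subseteq>
     sectional_curvature_range (stiefel2 :: (real^2^'n) set) (stiefel_metric \<alpha>)"
proof
  fix k assume "k \<in> closed_segment ((2 - 3 * \<alpha>) / 2) 1"
  then obtain u where u: "0 \<le> u" "u \<le> 1" "k = (1 - u) * ((2 - 3 * \<alpha>) / 2) + u"
    by (auto simp: closed_segment_def)
  define Y P Q :: "real^2^'n" where "Y = of_columns (axis a 1) (axis b 1)"
    and "P = of_columns (axis c 1) 0"
    and "Q = of_columns (sqrt u *\<^sub>R axis d 1) (sqrt (1 - u) *\<^sub>R axis c 1)"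
  note defs = Y_def P_def Q_def inner_columns colop_defs inner_axis_axis distinct distinct[symmetric]
    distinct_d distinct_d[symmetric]
  have "Y \<in> stiefel2" "horizontal Y P" "horizontal Y Q"
    by (simp_all add: stiefel2_iff_columns horizontal_def defs)
  moreover have *: "plane_area P Q = 1" "row_area P Q = u" "(P \<bullet> colrot Q)\<^sup>2 = 1 - u"
    using u(1,2) by (simp_all add: plane_area_def row_area_def defs)
  have "curvature_den \<alpha> P Q 0 0 = 1" "curvature_num \<alpha> P Q 0 0 = k"
    unfolding curvature_den_def curvature_num_def u(3) * by (simp_all add: field_simps)
  ultimately show "k \<in> sectional_curvature_range (stiefel2 :: (real^2^'n) set) (stiefel_metric \<alpha>)"
    unfolding sectional_curvature_range_stiefel2[OF \<alpha>]
    by (intro exI[of _ Y] exI[of _ P] exI[of _ Q] exI[of _ 0] exI[of _ 0]) simp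
qed

lemma segment_subset_range_0:
  "closed_segment 0 ((4 - 3 * \<alpha>) / 2) \<subseteq>
     sectional_curvature_range (stiefel2 :: (real^2^'n) set) (stiefel_metric \<alpha>)"
proof
  fix k assume "k \<in> closed_segment 0 ((4 - 3 * \<alpha>) / 2)"
  then obtain u where u: "0 \<le> u" "u \<le> 1" "k = u * ((4 - 3 * \<alpha>) / 2)"
    by (auto simp: closed_segment_def)
  \<comment> \<open>A point of the unit circle with \<open>r + s = sqrt (2 * u)\<close>. Both
    \<open>row_area\<close> and the squared \<open>colrot\<close> product equal
    \<open>(r + s)^2\<close>, so they grow together from 0 to the \<open>plane_area\<close>, which
    stays 2.\<close>
  define r s where "r = (sqrt u + sqrt (1 - u)) / sqrt 2" and "s = (sqrt u - sqrt (1 - u)) / sqrt 2"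
  have rs: "r\<^sup>2 + s\<^sup>2 = 1" "(r + s)\<^sup>2 = 2 * u"
    using u(1,2) by (simp_all add: r_def s_def power_divide power2_sum power2_diff field_simps)
  define Y P Q :: "real^2^'n" where "Y = of_columns (axis a 1) (axis b 1)"
    and "P = of_columns (r *\<^sub>R axis c 1) (s *\<^sub>R axis d 1)"
    and "Q = of_columns (- axis d 1) (axis c 1)"
  note defs = Y_def P_def Q_def inner_columns colop_defs inner_axis_axis distinct distinct[symmetric]
    distinct_d distinct_d[symmetric]
  have "Y \<in> stiefel2" "horizontal Y P" "horizontal Y Q"
    by (simp_all add: stiefel2_iff_columns horizontal_def defs)
  moreover have *: "plane_area P Q = 2 * (r\<^sup>2 + s\<^sup>2)" "row_area P Q = (r + s)\<^sup>2" "(P \<bullet> colrot Q)\<^sup>2 = (r + s)\<^sup>2"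
    by (simp_all add: plane_area_def row_area_def defs power2_eq_square field_simps)
  have "curvature_den \<alpha> P Q 0 0 = 2" "curvature_num \<alpha> P Q 0 0 = 2 * k"
    unfolding curvature_den_def curvature_num_def u(3) * rs by (simp_all add: field_simps)
  ultimately show "k \<in> sectional_curvature_range (stiefel2 :: (real^2^'n) set) (stiefel_metric \<alpha>)"
    unfolding sectional_curvature_range_stiefel2[OF \<alpha>]
    by (intro exI[of _ Y] exI[of _ P] exI[of _ Q] exI[of _ 0] exI[of _ 0]) simp
qed

end

end

section \<open>Bounds and the case distinction in \<alpha>\<close>

text \<open>The contributions of \<open>T\<close> to numerator and denominator have ratio
  \<open>\<alpha> / 2\<close>, between \<open>l\<close> and \<open>h\<close>, so only the horizontal
  part needs bounding. Stating \<open>bounds\<close> for arbitrary numbers makes each case a linear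
  estimate.\<close>

lemma sectional_curvature_range_bounds:
  assumes \<alpha>: "\<alpha> > 0"
    and k: "k \<in> sectional_curvature_range (stiefel2 :: (real^2^'n::finite) set) (stiefel_metric \<alpha>)"
    and bounds: "\<And>U W F. 0 \<le> U \<Longrightarrow> U \<le> F \<Longrightarrow> 0 \<le> W \<Longrightarrow> W \<le> F \<Longrightarrow> (CARD('n) = 3 \<longrightarrow> U = 0 \<and> W = F) \<Longrightarrow>
       l * F \<le> U + (1 - 3 * \<alpha> / 2) * W \<and> U + (1 - 3 * \<alpha> / 2) * W \<le> h * F"
    and "l \<le> \<alpha> / 2" "\<alpha> / 2 \<le> h"
  shows "k \<in> {l..h}"
proof -
  obtain Y P Q :: "real^2^'n" and A B where Y: "Y \<in> stiefel2" "horizontal Y P" "horizontal Y Q"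
    and den: "curvature_den \<alpha> P Q A B > 0"
    and k: "k = curvature_num \<alpha> P Q A B / curvature_den \<alpha> P Q A B"
    using k unfolding sectional_curvature_range_stiefel2[OF \<alpha>] by blast
  define T where "T = (B *\<^sub>R P - A *\<^sub>R Q) \<bullet> (B *\<^sub>R P - A *\<^sub>R Q)"
  have "\<alpha> * T \<ge> 0" using \<alpha> by (simp add: T_def)
  then have "l * (2 * (\<alpha> * T)) \<le> \<alpha> / 2 * (2 * (\<alpha> * T))" "\<alpha> / 2 * (2 * (\<alpha> * T)) \<le> h * (2 * (\<alpha> * T))"
    using assms(4,5) by (intro mult_right_mono; simp)+
  moreover have "\<alpha> / 2 * (2 * (\<alpha> * T)) = \<alpha>\<^sup>2 * T" by (simp add: power2_eq_square)
  moreover have "l * plane_area P Q \<le> row_area P Q + (1 - 3 * \<alpha> / 2) * (P \<bullet> colrot Q)\<^sup>2 \<and>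
      row_area P Q + (1 - 3 * \<alpha> / 2) * (P \<bullet> colrot Q)\<^sup>2 \<le> h * plane_area P Q"
    using areas_card_3[OF _ Y]
    by (intro bounds row_area_nonneg row_area_le inner_colrot_le) auto
  ultimately have "l * curvature_den \<alpha> P Q A B \<le> curvature_num \<alpha> P Q A B"
    "curvature_num \<alpha> P Q A B \<le> h * curvature_den \<alpha> P Q A B"
    unfolding curvature_den_def curvature_num_def T_def[symmetric] distrib_left mult.assoc
    by linarith+
  then show ?thesis
    using den unfolding k by (simp add: field_simps)
qed

theorem proposition1:
  fixes \<alpha> :: real
  assumes "CARD('n::finite) \<ge> 3" and "\<alpha> > 0"
  shows "let K = sectional_curvature_range (stiefel2 :: (real^2^'n) set) (stiefel_metric \<alpha>) in
         (CARD('n) = 3 \<longrightarrow>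
            (\<alpha> \<le> 1/2 \<longrightarrow> K = {\<alpha>/2 .. (2 - 3*\<alpha>)/2}) \<and>
            (\<alpha> > 1/2 \<longrightarrow> K = {(2 - 3*\<alpha>)/2 .. \<alpha>/2}) \<and>
            (\<alpha> < 2/3 \<longrightarrow> (\<forall>k\<in>K. k > 0))) \<and>
         (CARD('n) > 3 \<longrightarrow>
            (\<alpha> \<le> 2/3 \<longrightarrow> K = {0 .. (4 - 3*\<alpha>)/2}) \<and>
            (2/3 < \<alpha> \<and> \<alpha> \<le> 2 \<longrightarrow> K = {(2 - 3*\<alpha>)/2 .. 1}) \<and>
            (\<alpha> > 2 \<longrightarrow> K = {(2 - 3*\<alpha>)/2 .. \<alpha>/2}) \<and>
            (\<alpha> \<le> 2/3 \<longrightarrow> (\<forall>k\<in>K. k \<ge> 0)))"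
proof -
  define K where "K = sectional_curvature_range (stiefel2 :: (real^2^'n) set) (stiefel_metric \<alpha>)"
  let ?m = "1 - 3 * \<alpha> / 2"
  have bounds: "K \<subseteq> {l..h}"
    if "\<And>U W F. 0 \<le> U \<Longrightarrow> U \<le> F \<Longrightarrow> 0 \<le> W \<Longrightarrow> W \<le> F \<Longrightarrow> (CARD('n) = 3 \<longrightarrow> U = 0 \<and> W = F) \<Longrightarrow>
       l * F \<le> U + ?m * W \<and> U + ?m * W \<le> h * F" "l \<le> \<alpha> / 2" "\<alpha> / 2 \<le> h" for l h
    using sectional_curvature_range_bounds[OF assms(2) _ that] unfolding K_def by blast
  obtain S :: "'n set" where "card S = 3"
    using obtain_subset_with_card_n[OF assms(1)] by blast
  then obtain a b c :: 'n where abc: "S = {a, b, c}" "a \<noteq> b" "a \<noteq> c" "b \<noteq> c"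
    by (auto simp: card_3_iff)
  have seg3: "closed_segment (\<alpha> / 2) ((2 - 3 * \<alpha>) / 2) \<subseteq> K"
    unfolding K_def using segment_subset_range_3[OF assms(2) abc(2-4)] .
  have m: "(2 - 3 * \<alpha>) / 2 = ?m" "(4 - 3 * \<alpha>) / 2 = 1 + ?m" by (simp_all add: field_simps)
  have card3: "K = {\<alpha>/2..(2 - 3*\<alpha>)/2}" if "CARD('n) = 3" "\<alpha> \<le> 1/2"
  proof
    show "K \<subseteq> {\<alpha>/2..(2 - 3*\<alpha>)/2}"
      unfolding m
    proof (rule bounds)
      fix U W F :: real assume "0 \<le> U" "U \<le> F" "CARD('n) = 3 \<longrightarrow> U = 0 \<and> W = F"
      moreover from this have "\<alpha> / 2 * F \<le> ?m * F"
        using \<open>\<alpha> \<le> 1/2\<close> by (intro mult_right_mono) auto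
      ultimately show "\<alpha> / 2 * F \<le> U + ?m * W \<and> U + ?m * W \<le> ?m * F"
        using \<open>CARD('n) = 3\<close> by simp
    qed (use \<open>\<alpha> \<le> 1/2\<close> in auto)
    show "{\<alpha>/2..(2 - 3*\<alpha>)/2} \<subseteq> K"
      using seg3 \<open>\<alpha> \<le> 1/2\<close> by (simp add: closed_segment_eq_real_ivl)
  qed
  have card3': "K = {(2 - 3*\<alpha>)/2..\<alpha>/2}" if "CARD('n) = 3" "\<alpha> > 1/2"
  proof
    show "K \<subseteq> {(2 - 3*\<alpha>)/2..\<alpha>/2}"
      unfolding m
    proof (rule bounds)
      fix U W F :: real assume "0 \<le> U" "U \<le> F" "CARD('n) = 3 \<longrightarrow> U = 0 \<and> W = F"
      moreover from this have "?m * F \<le> \<alpha> / 2 * F"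
        using \<open>\<alpha> > 1/2\<close> by (intro mult_right_mono) auto
      ultimately show "?m * F \<le> U + ?m * W \<and> U + ?m * W \<le> \<alpha> / 2 * F"
        using \<open>CARD('n) = 3\<close> by simp
    qed (use \<open>\<alpha> > 1/2\<close> in auto)
    show "{(2 - 3*\<alpha>)/2..\<alpha>/2} \<subseteq> K"
      using seg3 \<open>\<alpha> > 1/2\<close> by (auto simp: closed_segment_eq_real_ivl)
  qed
  have fourth: "\<exists>d. a \<noteq> d \<and> b \<noteq> d \<and> c \<noteq> d" if "CARD('n) > 3"
  proof (rule ccontr)
    assume "\<nexists>d. a \<noteq> d \<and> b \<noteq> d \<and> c \<noteq> d"
    then have "S = UNIV" using abc(1) by auto
    then show False using that \<open>card S = 3\<close> by simp
  qed
  have le: "K = {0..(4 - 3*\<alpha>)/2}" if "CARD('n) > 3" "\<alpha> \<le> 2/3"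
  proof
    show "K \<subseteq> {0..(4 - 3*\<alpha>)/2}"
      unfolding m
    proof (rule bounds)
      fix U W F :: real assume "0 \<le> U" "U \<le> F" "0 \<le> W" "W \<le> F"
      moreover from this have "0 \<le> ?m * W" "?m * W \<le> ?m * F"
        using \<open>\<alpha> \<le> 2/3\<close> by (auto intro!: mult_left_mono)
      ultimately show "0 * F \<le> U + ?m * W \<and> U + ?m * W \<le> (1 + ?m) * F"
        by (simp add: algebra_simps)
    qed (use that assms(2) in auto)
    obtain d where "a \<noteq> d" "b \<noteq> d" "c \<noteq> d" using fourth[OF \<open>CARD('n) > 3\<close>] by blast
    then show "{0..(4 - 3*\<alpha>)/2} \<subseteq> K"
      unfolding K_def using segment_subset_range_0[OF assms(2) abc(2-4)] that(2)
      by (simp add: closed_segment_eq_real_ivl)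
  qed
  \<comment> \<open>Here \<open>?m\<close> is negative, so the term with \<open>W\<close> is
    smallest at \<open>W = F\<close> and largest at \<open>W = 0\<close>.\<close>
  have neg: "?m * F \<le> U + ?m * W" "U + ?m * W \<le> F"
    if "\<alpha> > 2/3" "0 \<le> U" "U \<le> F" "0 \<le> W" "W \<le> F" for U W F
  proof -
    have "?m * F \<le> ?m * W" using that by (intro mult_left_mono_neg) auto
    moreover have "?m * W \<le> 0" using that by (intro mult_nonpos_nonneg) auto
    ultimately show "?m * F \<le> U + ?m * W" "U + ?m * W \<le> F" using that by linarith+
  qed
  have mid: "K = {(2 - 3*\<alpha>)/2..1}" if "CARD('n) > 3" "2/3 < \<alpha>" "\<alpha> \<le> 2"
  proof
    show "K \<subseteq> {(2 - 3*\<alpha>)/2..1}"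
      unfolding m by (rule bounds) (use that neg in auto)
    obtain d where "a \<noteq> d" "b \<noteq> d" "c \<noteq> d" using fourth[OF \<open>CARD('n) > 3\<close>] by blast
    then show "{(2 - 3*\<alpha>)/2..1} \<subseteq> K"
      unfolding K_def using segment_subset_range_1[OF assms(2) abc(2-4)] that(2)
      by (simp add: closed_segment_eq_real_ivl)
  qed
  have ge: "K = {(2 - 3*\<alpha>)/2..\<alpha>/2}" if "CARD('n) > 3" "\<alpha> > 2"
  proof
    show "K \<subseteq> {(2 - 3*\<alpha>)/2..\<alpha>/2}"
      unfolding m
    proof (rule bounds)
      fix U W F :: real assume *: "0 \<le> U" "U \<le> F" "0 \<le> W" "W \<le> F"
      \<comment> \<open>Now \<open>\<alpha> / 2\<close> exceeds 1, so the maximum is attained on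
        sections containing \<open>colrot Y\<close> instead of horizontal ones.\<close>
      have "1 * F \<le> \<alpha> / 2 * F"
        using that * by (intro mult_right_mono) auto
      then show "?m * F \<le> U + ?m * W \<and> U + ?m * W \<le> \<alpha> / 2 * F"
        using neg[OF _ *] that by simp
    qed (use that in auto)
    show "{(2 - 3*\<alpha>)/2..\<alpha>/2} \<subseteq> K"
      using seg3 that(2) by (auto simp: closed_segment_eq_real_ivl)
  qed
  show ?thesis
    unfolding Let_def K_def[symmetric] using card3 card3' le mid ge assms(2)
    by (cases "\<alpha> \<le> 1/2") auto
qed

end
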